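(* Let $\mathcal M$ be a collection of càdlàg strong Markov processes on $[0,T]$ taking values in a Polish space $(E,d)$. Suppose that (a) $(M(\mathbf X))_{\mathbf X\in\mathcal M}$ is tight, and (b) there exist constants $a,\kappa,b>0$ and $c\in[0,1/2)$ such that for all $\delta\in(0,b]$ $$\sup_{\mathbf X\in\mathcal M}\ \sup_{s\in R_{\mathbf X}}\ \sup_{x\in E}\ \sup_{t\in[s,s+h(\delta)]}\mathbb P^{s,x}\big[d(\mathbf X_s,\mathbf X_t)>\delta\big]\le c,$$ where $h(\delta):=a\delta^\kappa$. Then for any $p>\kappa$, $(\|\mathbf X\|_{p\text{-var};[0,T]})_{\mathbf X\in\mathcal M}$ is a tight collection of real random variables.
   Context: $M(\mathbf x):=\sup_{s,t\in[0,T]}d(\mathbf x_t,\mathbf x_s)$ for $\mathbf x:[0,T]\to E$. $\|\mathbf x\|_{p\text{-var};[0,T]}=\sup_{\mathcal D}\big(\sum_{t_j\in\mathcal D}d(\mathbf x_{t_j},\mathbf x_{t_{j+1}})^p\big)^{1/p}$, the supremum over partitions of $[0,T]$. For a Markov process $\mathbf X$, $\mathbb P^{s,x}$ denotes the law under which the process is started from $x$ at time $s$ (i.e. $\mathbf X_s=x$) and evolves with the transition probabilities of $\mathbf X$. Times $t$ are understood to lie in $[0,T]$, i.e. $t\in[s,s+h(\delta)]\cap[0,T]$. For a $D([0,T],E)$-valued random variable $\mathbf X$, a deterministic open interval $(s,t)\subset[0,T]$ is called stationary if $\mathbb P[\forall u\in(s,t),\ \mathbf X_u=\mathbf X_s]=1$.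 $Z_{\mathbf X}\subseteq[0,T]$ is the union of all stationary intervals and $R_{\mathbf X}=[0,T]\setminus Z_{\mathbf X}$. *)

theory Defs
  imports "HOL-Probability.Probability"
begin

definition cadlag_on :: "real \<Rightarrow> (real \<Rightarrow> 'e::topological_space) \<Rightarrow> bool" where
  "cadlag_on T x \<longleftrightarrow>
     (\<forall>t\<in>{0..<T}. (x \<longlongrightarrow> x t) (at_right t)) \<and>
     (\<forall>t\<in>{0<..T}. \<exists>l. (x \<longlongrightarrow> l) (at_left t))"

text \<open>The quantity \<open>M(x)\<close>. The supremum is a real one; for a cadlag path on \<open>[0,T]\<close>
  the set of distances is nonempty and bounded, so it is a genuine supremum.\<close>

definition max_osc :: "real \<Rightarrow> (real \<Rightarrow> 'e::metric_space) \<Rightarrow> real" where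
  "max_osc T x = (SUP (s, t)\<in>{0..T} \<times> {0..T}. dist (x t) (x s))"

text \<open>Partitions \<open>0 = t 0 < t 1 < \<dots> < t n = T\<close>.\<close>

definition partitions :: "real \<Rightarrow> (nat \<times> (nat \<Rightarrow> real)) set" where
  "partitions T = {(n, t). t 0 = 0 \<and> t n = T \<and> (\<forall>j<n. t j < t (Suc j))}"

definition pvar :: "real \<Rightarrow> real \<Rightarrow> (real \<Rightarrow> 'e::metric_space) \<Rightarrow> ennreal" where
  "pvar p T x = (SUP (n, t)\<in>partitions T.
     ennreal ((\<Sum>j<n. dist (x (t j)) (x (t (Suc j))) powr p) powr (1 / p)))"

text \<open>Tightness of a family of real random variables, each on its own probability space.\<close>

definition tight_family :: "'i set \<Rightarrow> ('i \<Rightarrow> 'w measure) \<Rightarrow> ('i \<Rightarrow> 'w \<Rightarrow> real) \<Rightarrow> bool" where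
  "tight_family I M Y \<longleftrightarrow>
     (\<forall>i\<in>I. Y i \<in> borel_measurable (M i)) \<and>
     (\<forall>\<epsilon>>0. \<exists>K. compact K \<and> (\<forall>i\<in>I. \<P>(\<omega> in M i. Y i \<omega> \<notin> K) \<le> \<epsilon>))"

text \<open>Time-inhomogeneous Markov transition probabilities on \<open>[0,T]\<close>: \<open>Q s t x B\<close> is the
  probability to be in \<open>B\<close> at time \<open>t\<close> when in \<open>x\<close> at time \<open>s\<close>; the last clause is the
  Chapman-Kolmogorov equation.\<close>

definition transition_function ::
  "real \<Rightarrow> (real \<Rightarrow> real \<Rightarrow> 'e::topological_space \<Rightarrow> 'e measure) \<Rightarrow> bool" where
  "transition_function T Q \<longleftrightarrow>
     (\<forall>s\<in>{0..T}. \<forall>t\<in>{s..T}. Q s t \<in> borel \<rightarrow>\<^sub>M prob_algebra borel) \<and>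
     (\<forall>s\<in>{0..T}. \<forall>x. Q s s x = return borel x) \<and>
     (\<forall>s\<in>{0..T}. \<forall>t\<in>{s..T}. \<forall>u\<in>{t..T}. \<forall>x. Q s u x = Q s t x \<bind> Q t u)"

text \<open>Characterization of the law \<open>P\<^sup>s\<^sup>,\<^sup>x\<close> on the path space \<open>E\<^bsup>[s,T]\<^esup>\<close>: the
  coordinate process starts from \<open>x\<close> at time \<open>s\<close> and is Markov with transition probabilities
  \<open>Q\<close> for its natural filtration. By Kolmogorov's theorem there is exactly one such law.\<close>

definition markov_law ::
  "real \<Rightarrow> (real \<Rightarrow> real \<Rightarrow> 'e::topological_space \<Rightarrow> 'e measure) \<Rightarrow> real \<Rightarrow> 'e
     \<Rightarrow> (real \<Rightarrow> 'e) measure \<Rightarrow> bool" where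
  "markov_law T Q s x P \<longleftrightarrow>
     prob_space P \<and> sets P = sets (Pi\<^sub>M {s..T} (\<lambda>_. borel)) \<and>
     (AE \<omega> in P. \<omega> s = x) \<and>
     (\<forall>t\<in>{s..T}. \<forall>u\<in>{t..T}. \<forall>B\<in>sets borel.
        AE \<omega> in P.
          real_cond_exp P
            (vimage_algebra (space P) (\<lambda>\<omega>. restrict \<omega> {s..t}) (Pi\<^sub>M {s..t} (\<lambda>_. borel)))
            (indicator {\<omega>\<in>space P. \<omega> u \<in> B}) \<omega>
          = measure (Q t u (\<omega> t)) B)"

text \<open>A Markov process comes with its own filtered probability space and with transition
  probabilities defined for all starting points. \<open>mp_law Z s x\<close> is \<open>P\<^sup>s\<^sup>,\<^sup>x\<close>, which is
  determined by \<open>mp_trans Z\<close>. The law of the process itself is that under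
  \<open>mp_space Z\<close>, with arbitrary initial distribution.\<close>

record ('w, 'e) markov_process =
  mp_space :: "'w measure"
  mp_filt :: "real \<Rightarrow> 'w measure"
  mp_val :: "real \<Rightarrow> 'w \<Rightarrow> 'e"
  mp_trans :: "real \<Rightarrow> real \<Rightarrow> 'e \<Rightarrow> 'e measure"
  mp_law :: "real \<Rightarrow> 'e \<Rightarrow> (real \<Rightarrow> 'e) measure"

text \<open>The filtration is indexed by all reals in order to use the library's stopping times; only
  its members with index in \<open>[0,T]\<close> matter for stopping times with values in \<open>[0,T]\<close>.
  The last clause is the strong Markov property:
  \<open>P[X\<^sub>\<tau>\<^sub>+\<^sub>u \<in> B | F\<^sub>\<tau>] = Q \<tau> (\<tau>+u) X\<^sub>\<tau> B\<close> almost surely on \<open>\<tau> + u \<le> T\<close>.\<close>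

definition cadlag_strong_markov ::
  "real \<Rightarrow> ('w, 'e::topological_space) markov_process \<Rightarrow> bool" where
  "cadlag_strong_markov T Z \<longleftrightarrow>
     (let M = mp_space Z; F = mp_filt Z; X = mp_val Z; Q = mp_trans Z in
       prob_space M \<and> filtration (space M) F \<and> (\<forall>t. subalgebra M (F t)) \<and>
       (\<forall>t\<in>{0..T}. X t \<in> borel_measurable (F t)) \<and>
       (\<forall>\<omega>\<in>space M. cadlag_on T (\<lambda>t. X t \<omega>)) \<and>
       transition_function T Q \<and>
       (\<forall>s\<in>{0..T}. \<forall>x. markov_law T Q s x (mp_law Z s x)) \<and>
       (\<forall>\<tau>. stopping_time F \<tau> \<and> (\<forall>\<omega>\<in>space M. \<tau> \<omega> \<in> {0..T}) \<longrightarrow>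
          (\<forall>u\<ge>0. \<forall>B\<in>sets borel.
             AE \<omega> in M.
               real_cond_exp M (filtration.pre_sigma (space M) F \<tau>)
                 (indicator {\<omega>\<in>space M. \<tau> \<omega> + u \<le> T \<and> X (\<tau> \<omega> + u) \<omega> \<in> B}) \<omega>
               = indicator {\<omega>. \<tau> \<omega> + u \<le> T} \<omega>
                   * measure (Q (\<tau> \<omega>) (\<tau> \<omega> + u) (X (\<tau> \<omega>) \<omega>)) B)))"

text \<open>The open interval \<open>(s,t)\<close> is given by its endpoints; note that \<open>X\<close> is compared
  with its value at the left endpoint, which is not in the interval.\<close>

definition stationary_interval ::
  "real \<Rightarrow> ('w, 'e) markov_process \<Rightarrow> real \<Rightarrow> real \<Rightarrow> bool" where
  "stationary_interval T Z s t \<longleftrightarrow>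
     0 \<le> s \<and> s < t \<and> t \<le> T \<and>
     (AE \<omega> in mp_space Z. \<forall>u\<in>{s<..<t}. mp_val Z u \<omega> = mp_val Z s \<omega>)"

definition Z_set :: "real \<Rightarrow> ('w, 'e) markov_process \<Rightarrow> real set" where
  "Z_set T Z = \<Union>{{s<..<t} | s t. stationary_interval T Z s t}"

definition R_set :: "real \<Rightarrow> ('w, 'e) markov_process \<Rightarrow> real set" where
  "R_set T Z = {0..T} - Z_set T Z"

end

(* Fix a finite set of times in R_X and a scale r. Call a time a reset if X has moved by more than 2r
   since the previous reset. Since c < 1/2, Ottaviani's inequality bounds the conditional probability
   of a further reset within h(r) by c/(1-c) < 1, while at most T/h(r) + 1 gaps between resets are
   longer than h(r). So the expected number of resets is O(r powr -\<kappa>), uniformly in the process and in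
   the finite set. A partition has no more increments above 4r than there are resets, and summing over
   the dyadic scales r = b/2^j bounds the p-th power sum if p > \<kappa>; the finitely many increments above
   4b are controlled by M(X). A time outside R_X is replaced by the last preceding time in R_X, which
   almost surely does not change X; right continuity then yields all partitions. As only finite
   sets of times occur, the strong Markov property is used at deterministic times only. *)

theory Submission
  imports Defs
begin

section \<open>Counting large increments\<close>

text \<open>Hypothesis (b) bounds the displacement between two fixed times only, and the number of
  resets before a given one is random. The count is therefore organised by index and not by
  successive reset times: a reset at index \<open>i\<close> is an event known at time
  \<open>t i\<close>, so the conditional bound applies to it. With \<open>S\<close> the expected
  number of resets and \<open>h\<close> the time span for scale \<open>r\<close>, summing over
  \<open>i\<close> gives \<open>(1 - c) * S \<le> (1 - c) * (T / h + 1) + c * S\<close>, which can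
  be solved for \<open>S\<close> because \<open>c < 1/2\<close>; this is the origin of the factor
  \<open>(1 - c) / (1 - 2 * c)\<close>. Resets depend on the sampled path and the scale, not on the
  partition. Hence one exceptional event serves all partitions with points among the sampled times,
  as a supremum inside the probability requires. Increments of size about \<open>r\<close>
  contribute at most a multiple of \<open>r powr (p - \<kappa>)\<close> in expectation, whence a
  geometric series over dyadic scales. Passing from a fixed starting point \<open>x\<close> to
  conditioning on the past triples the threshold, so \<open>a\<close> and \<open>b\<close> become
  \<open>a / 3 powr \<kappa>\<close> and \<open>3 * b\<close>.\<close>

primrec anchor :: "real \<Rightarrow> (nat \<Rightarrow> 'e::metric_space) \<Rightarrow> nat \<Rightarrow> nat" where
  "anchor r y 0 = 0"
| "anchor r y (Suc i) =
     (if 2 * r < dist (y (anchor r y i)) (y (Suc i)) then Suc i else anchor r y i)"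

text \<open>A reset happens exactly at the indices that are their own anchor. Index 0 always
  counts.\<close>

definition resets :: "real \<Rightarrow> (nat \<Rightarrow> 'e::metric_space) \<Rightarrow> nat \<Rightarrow> nat set" where
  "resets r y n = {k \<in> {..n}. anchor r y k = k}"

lemma finite_resets [simp]: "finite (resets r y n)"
  by (simp add: resets_def)

lemma anchor_le: "anchor r y i \<le> i"
  by (induction i) auto

lemma dist_anchor_le: "0 \<le> r \<Longrightarrow> dist (y (anchor r y i)) (y i) \<le> 2 * r"
  by (induction i) auto

lemma anchor_unchanged:
  assumes "i \<le> k" "\<And>m. i < m \<Longrightarrow> m \<le> k \<Longrightarrow> anchor r y m \<noteq> m"
  shows "anchor r y k = anchor r y i"
  using assms
proof (induction k rule: dec_induct)
  case (step n)
  have "anchor r y n = anchor r y i" using step.prems by (intro step.IH) auto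
  moreover have "anchor r y (Suc n) \<noteq> Suc n" using step.hyps by (intro step.prems) auto
  ultimately show ?case by (auto split: if_splits)
qed simp

text \<open>Without a reset after \<open>i\<close> and up to \<open>k\<close>, both values lie
  within \<open>2 * r\<close> of the same anchor value. This is where the threshold
  \<open>4 * r\<close> comes from.\<close>

lemma reset_between:
  assumes "0 \<le> r" "i \<le> k" "4 * r < dist (y i) (y k)"
  obtains m where "i < m" "m \<le> k" "anchor r y m = m"
proof (rule ccontr)
  assume "\<not> thesis"
  then have "anchor r y k = anchor r y i"
    using anchor_unchanged[OF \<open>i \<le> k\<close>] that by metis
  then have "dist (y i) (y k) \<le> 2 * r + 2 * r"
    using dist_anchor_le[OF \<open>0 \<le> r\<close>, where y = y and i = i]
      dist_anchor_le[OF \<open>0 \<le> r\<close>, where y = y and i = k]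
    using dist_triangle3[of "y i" "y k" "y (anchor r y i)"] by simp
  then show False using assms by simp
qed

text \<open>While \<open>y\<close> stays within \<open>2 * r\<close> of \<open>y i\<close>, the
  anchor stays at \<open>i\<close>, so \<open>k\<close> cannot become its own anchor. A later reset
  thus forces the kind of exit that Ottaviani's inequality bounds.\<close>

lemma exit_between_resets:
  assumes "anchor r y i = i" "anchor r y k = k" "i < k"
  obtains m where "i < m" "m \<le> k" "2 * r < dist (y i) (y m)"
proof (rule ccontr)
  assume *: "\<not> thesis"
  have no_exit: "\<not> (i < m \<and> m \<le> k \<and> 2 * r < dist (y i) (y m))" for m
    using * that by blast
  have "m \<le> k \<Longrightarrow> anchor r y m = i" if "i \<le> m" for m
    using that
  proof (induction m rule: dec_induct)
    case (step m)
    then show ?case using no_exit[of "Suc m"] by auto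
  qed (use assms in auto)
  from this[of k] show False using assms by simp
qed

text \<open>Each large increment contains a reset in the half-open index interval from
  \<open>u j\<close> (excluded) to \<open>u (Suc j)\<close>. These intervals are disjoint, so
  choosing one reset in each is injective.\<close>

lemma card_large_increments_le:
  assumes "0 \<le> r" and u: "\<And>j. j < m \<Longrightarrow> u j \<le> u (Suc j)" and "u m \<le> n"
  shows "card {j. j < m \<and> 4 * r < dist (y (u j)) (y (u (Suc j)))} \<le> card (resets r y n)"
proof -
  let ?J = "{j. j < m \<and> 4 * r < dist (y (u j)) (y (u (Suc j)))}"
  have "\<exists>k. u j < k \<and> k \<le> u (Suc j) \<and> anchor r y k = k" if "j \<in> ?J" for j
    using that u[of j] reset_between[OF \<open>0 \<le> r\<close>, of "u j" "u (Suc j)" y] by blast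
  then have "\<forall>j\<in>?J. \<exists>k. u j < k \<and> k \<le> u (Suc j) \<and> anchor r y k = k" by blast
  from bchoice[OF this] obtain g where
    g: "\<And>j. j \<in> ?J \<Longrightarrow> u j < g j \<and> g j \<le> u (Suc j) \<and> anchor r y (g j) = g j"
    by blast
  have mono: "j' \<le> m \<Longrightarrow> u j \<le> u j'" if "j \<le> j'" for j j'
    using that by (induction j' rule: dec_induct) (auto intro: order_trans[OF _ u])
  have less: "g i < g j" if "i \<in> ?J" "j \<in> ?J" "i < j" for i j
  proof -
    have "g i \<le> u (Suc i)" "u j < g j" "u (Suc i) \<le> u j"
      using g[OF that(1)] g[OF that(2)] mono[of "Suc i" j] that by auto
    then show ?thesis by simp
  qed
  show ?thesis
  proof (rule card_inj_on_le)
    show "inj_on g ?J"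
      by (rule linorder_inj_onI') (simp add: less less_imp_neq)
    show "g ` ?J \<subseteq> resets r y n"
    proof (clarsimp simp: resets_def)
      fix j assume j: "j < m" "4 * r < dist (y (u j)) (y (u (Suc j)))"
      have "u (Suc j) \<le> u m" using j by (intro mono) auto
      then show "g j \<le> n \<and> anchor r y (g j) = g j" using g[of j] j assms(3) by auto
    qed
  qed simp
qed

text \<open>Points more than \<open>h\<close> apart have different values of the floor of
  \<open>t i / h\<close>. For empty \<open>S\<close> nothing forces \<open>T\<close> to be
  nonnegative, hence \<open>max 0 T\<close>.\<close>

lemma card_separated_le:
  fixes t :: "nat \<Rightarrow> real"
  assumes "finite S" "0 < h" and range: "\<And>i. i \<in> S \<Longrightarrow> 0 \<le> t i \<and> t i \<le> T"
    and sep: "\<And>i k. i \<in> S \<Longrightarrow> k \<in> S \<Longrightarrow> i < k \<Longrightarrow> h < t k - t i"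
  shows "real (card S) \<le> max 0 T / h + 1"
proof (cases "S = {}")
  case False
  then have T: "0 \<le> T" using range by force
  let ?f = "\<lambda>i. \<lfloor>t i / h\<rfloor>"
  have less: "?f i < ?f k" if "i \<in> S" "k \<in> S" "i < k" for i k
  proof -
    have "t i / h + 1 < t k / h" using sep[OF that] \<open>0 < h\<close> by (simp add: less_divide_eq distrib_right)
    then show ?thesis by linarith
  qed
  have "card S \<le> card {0..\<lfloor>T / h\<rfloor>}"
  proof (rule card_inj_on_le)
    show "inj_on ?f S"
      by (rule linorder_inj_onI') (simp add: less less_imp_neq)
    show "?f ` S \<subseteq> {0..\<lfloor>T / h\<rfloor>}"
      using range \<open>0 < h\<close> by (auto intro!: floor_mono divide_right_mono)
  qed simp
  then have "real (card S) \<le> of_int \<lfloor>T / h\<rfloor> + 1"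
    using T \<open>0 < h\<close> by (simp add: le_nat_iff)
  then show ?thesis using T by linarith
qed (use \<open>0 < h\<close> in simp)

text \<open>A positive \<open>d\<close> that is at most \<open>4 * b\<close> lies between two
  consecutive dyadic levels \<open>4 * b * (1/2) ^ Suc j\<close> and
  \<open>4 * b * (1/2) ^ j\<close>, and the summand for this \<open>j\<close> alone dominates. The
  lower level is four times the scale \<open>b * (1/2) ^ Suc j\<close>, so its indicator is of the
  kind that resets count. In \<open>ennreal\<close> the series needs no convergence proof.\<close>

lemma powr_le_scale_sum:
  fixes d b p M :: real
  assumes "0 < b" "0 < p" "0 \<le> d" "d \<le> M"
  shows "ennreal (d powr p) \<le>
    (\<Sum>j. ennreal ((4 * b * (1/2) ^ j) powr p) * of_bool (4 * (b * (1/2) ^ Suc j) < d))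
    + ennreal (M powr p) * of_bool (4 * b < d)"
proof (cases "4 * b < d \<or> d = 0")
  case True
  then show ?thesis
    using assms by (auto intro!: add_increasing ennreal_leI powr_mono2)
next
  case False
  then have d: "0 < d" "d \<le> 4 * b" using assms by auto
  have "(\<lambda>j. 4 * b * (1/2) ^ j) \<longlonglongrightarrow> 4 * b * 0"
    by (intro tendsto_intros LIMSEQ_realpow_zero) auto
  then have "\<forall>\<^sub>F j in sequentially. 4 * b * (1/2) ^ j < d"
    using d by (auto simp: order_tendsto_iff)
  then have ex: "\<exists>j. 4 * b * (1/2) ^ j < d"
    by (auto simp: eventually_sequentially)
  \<comment> \<open>The first level below \<open>d\<close>. It is not level 0, because
    \<open>d \<le> 4 * b\<close>, so its predecessor exists and is at least \<open>d\<close> by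
    minimality.\<close>
  define m where "m = (LEAST j. 4 * b * (1/2) ^ j < d)"
  have m: "4 * b * (1/2) ^ m < d" unfolding m_def using ex by (rule LeastI_ex)
  then obtain j where j: "m = Suc j" using d by (cases m) auto
  have "d \<le> 4 * b * (1/2) ^ j"
    using not_less_Least[of j "\<lambda>j. 4 * b * (1/2) ^ j < d"] j by (auto simp: m_def)
  then have "ennreal (d powr p) \<le> ennreal ((4 * b * (1/2) ^ j) powr p)
      * of_bool (4 * (b * (1/2) ^ Suc j) < d)"
    using m d assms unfolding j by (auto intro!: ennreal_leI powr_mono2)
  also have "\<dots> \<le> (\<Sum>j. ennreal ((4 * b * (1/2) ^ j) powr p) * of_bool (4 * (b * (1/2) ^ Suc j) < d))"
    by (rule sum_le_suminf[OF summableI, of "{j}", simplified sum.insert_remove, simplified])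
  finally show ?thesis by (rule add_increasing2[OF zero_le])
qed

text \<open>Exchange the sum over increments with the sum over scales and count at each scale. The
  right-hand side mentions neither \<open>m\<close> nor \<open>u\<close>, so the bound holds for all
  subsequences of the sample at once.\<close>

lemma sum_powr_le_resets:
  fixes y :: "nat \<Rightarrow> 'e::metric_space"
  assumes "0 < b" "0 < p" and u: "\<And>j. j < m \<Longrightarrow> u j \<le> u (Suc j)" and "u m \<le> n"
    and M: "\<And>i k. i \<le> n \<Longrightarrow> k \<le> n \<Longrightarrow> dist (y i) (y k) \<le> M"
  shows "ennreal (\<Sum>j<m. dist (y (u j)) (y (u (Suc j))) powr p) \<le>
    (\<Sum>j. ennreal ((4 * b * (1/2) ^ j) powr p) * of_nat (card (resets (b * (1/2) ^ Suc j) y n)))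
    + ennreal (M powr p) * of_nat (card (resets b y n))"
proof -
  let ?d = "\<lambda>i. dist (y (u i)) (y (u (Suc i)))"
  have mono: "j' \<le> m \<Longrightarrow> u j \<le> u j'" if "j \<le> j'" for j j'
    using that by (induction j' rule: dec_induct) (auto intro: order_trans[OF _ u])
  have d: "?d i \<le> M" if "i < m" for i
    using that mono[of i m] mono[of "Suc i" m] \<open>u m \<le> n\<close> by (intro M) auto
  have cnt: "(\<Sum>i<m. of_bool (4 * r < ?d i)) \<le> (of_nat (card (resets r y n)) :: ennreal)"
    if "0 \<le> r" for r
  proof -
    have "(\<Sum>i<m. of_bool (4 * r < ?d i) :: ennreal) = of_nat (card {j. j < m \<and> 4 * r < ?d j})"
      by (simp add: sum_of_bool_eq Int_def)
    also have "\<dots> \<le> of_nat (card (resets r y n))"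
      using card_large_increments_le[OF that u \<open>u m \<le> n\<close>] by simp
    finally show ?thesis .
  qed
  have "ennreal (\<Sum>i<m. ?d i powr p) = (\<Sum>i<m. ennreal (?d i powr p))"
    by simp
  also have "\<dots> \<le> (\<Sum>i<m.
    (\<Sum>j. ennreal ((4 * b * (1/2) ^ j) powr p) * of_bool (4 * (b * (1/2) ^ Suc j) < ?d i))
    + ennreal (M powr p) * of_bool (4 * b < ?d i))"
    using assms d by (intro sum_mono powr_le_scale_sum) auto
  also have "\<dots> = (\<Sum>j. ennreal ((4 * b * (1/2) ^ j) powr p) * (\<Sum>i<m. of_bool (4 * (b * (1/2) ^ Suc j) < ?d i)))
    + ennreal (M powr p) * (\<Sum>i<m. of_bool (4 * b < ?d i))"
    unfolding sum.distrib sum_distrib_left by (subst suminf_sum) auto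
  also have "\<dots> \<le> (\<Sum>j. ennreal ((4 * b * (1/2) ^ j) powr p) * of_nat (card (resets (b * (1/2) ^ Suc j) y n)))
    + ennreal (M powr p) * of_nat (card (resets b y n))"
    using \<open>0 < b\<close> by (intro add_mono suminf_le mult_left_mono cnt) auto
  finally show ?thesis .
qed

section \<open>Expected number of resets\<close>

text \<open>One scale \<open>r\<close> with its time span \<open>h\<close>. The assumption
  \<open>step\<close> is the conditional bound given \<open>G i\<close>, integrated over an event of
  \<open>G i\<close>, so that no conditional expectation occurs. The times are merely nondecreasing,
  because a finite sample is continued constantly to all indices.\<close>

locale sampled_process = prob_space M for M :: "'w measure" +
  fixes G :: "nat \<Rightarrow> 'w measure" and Y :: "nat \<Rightarrow> 'w \<Rightarrow> 'e::polish_space"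
    and t :: "nat \<Rightarrow> real" and r h c :: real
  assumes subalgebra: "\<And>i. subalgebra M (G i)"
    and sets_mono: "\<And>i k. i \<le> k \<Longrightarrow> sets (G i) \<subseteq> sets (G k)"
    and adapted: "\<And>i. Y i \<in> borel_measurable (G i)"
    and t_mono: "mono t"
    and r_nonneg: "0 \<le> r" and h_pos: "0 < h" and c_nonneg: "0 \<le> c" and c_half: "c < 1/2"
    and step: "\<And>i k A. i \<le> k \<Longrightarrow> t k - t i \<le> h \<Longrightarrow> A \<in> sets (G i) \<Longrightarrow>
      prob (A \<inter> {\<omega> \<in> space M. r < dist (Y i \<omega>) (Y k \<omega>)}) \<le> c * prob A"
begin

lemma space_G: "space (G i) = space M"
  using subalgebra[of i] by (simp add: subalgebra_def)

lemma sets_G: "A \<in> sets (G i) \<Longrightarrow> A \<in> sets M"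
  using subalgebra[of i] by (auto simp: subalgebra_def)

lemma adapted_mono: "i \<le> k \<Longrightarrow> Y i \<in> borel_measurable (G k)"
  using adapted[of i] sets_mono[of i k] space_G
  by (auto simp: measurable_def)

lemma measurable_Y [measurable]: "Y i \<in> borel_measurable M"
  using adapted[of i] subalgebra[of i] by (rule measurable_from_subalg[rotated])

lemma dist_event [measurable]:
  assumes "i \<le> k" "j \<le> k"
  shows "{\<omega> \<in> space M. l < dist (Y i \<omega>) (Y j \<omega>)} \<in> sets (G k)"
proof -
  have [measurable]: "Y i \<in> borel_measurable (G k)" "Y j \<in> borel_measurable (G k)"
    using adapted_mono assms by auto
  have "{\<omega> \<in> space (G k). l < dist (Y i \<omega>) (Y j \<omega>)} \<in> sets (G k)"
    by measurable
  then show ?thesis by (simp add: space_G)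
qed

text \<open>Split according to the first index \<open>k\<close> at which the path is further than
  \<open>2 * r\<close> from \<open>Y i\<close>. From there to \<open>e\<close> at most time
  \<open>h\<close> passes, so given \<open>G k\<close> the path ends within \<open>r\<close> of
  \<open>Y k\<close> with probability at least \<open>1 - c\<close>. It is then still further than
  \<open>r\<close> from \<open>Y i\<close>, and \<open>step\<close> from \<open>i\<close> to
  \<open>e\<close> bounds that event by \<open>c * prob A\<close>.\<close>

lemma ottaviani:
  assumes "i \<le> e" "t e - t i \<le> h" and A: "A \<in> sets (G i)"
  shows "(1 - c) * prob (A \<inter> {\<omega> \<in> space M. \<exists>k\<in>{i<..e}. 2 * r < dist (Y i \<omega>) (Y k \<omega>)})
    \<le> c * prob A"
proof -
  \<comment> \<open>The first exit takes place at index \<open>k\<close>. Only values up to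
    \<open>k\<close> are involved, so \<open>step\<close> may be restarted at \<open>k\<close> on
    this event.\<close>
  define B where "B k = A \<inter> {\<omega> \<in> space M. 2 * r < dist (Y i \<omega>) (Y k \<omega>)}
      - (\<Union>m\<in>{i<..<k}. {\<omega> \<in> space M. 2 * r < dist (Y i \<omega>) (Y m \<omega>)})" for k
  have B_G: "B k \<in> sets (G k)" if "i < k" for k
    unfolding B_def using that A sets_mono[of i k] by (intro sets.Diff sets.Int sets.finite_UN) auto
  then have B[measurable]: "B k \<in> sets M" if "i < k" for k using that sets_G by blast
  have [measurable]: "A \<in> sets M" using A sets_G by blast
  have disj: "disjoint_family_on B {i<..e}"
    unfolding disjoint_family_on_def
  proof (intro ballI impI)
    fix k l :: nat assume "k \<noteq> l" "k \<in> {i<..e}" "l \<in> {i<..e}"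
    then show "B k \<inter> B l = {}"
      by (cases k l rule: linorder_cases) (auto simp: B_def)
  qed
  define far where "far k = {\<omega> \<in> space M. r < dist (Y k \<omega>) (Y e \<omega>)}" for k
  have far[measurable]: "far k \<in> sets M" for k unfolding far_def by measurable
  have B_step: "(1 - c) * prob (B k) \<le> prob (B k - far k)" if k: "k \<in> {i<..e}" for k
  proof -
    have "t i \<le> t k" using t_mono k by (auto simp: mono_def)
    then have "prob (B k \<inter> far k) \<le> c * prob (B k)"
      unfolding far_def using k assms(2) by (intro step B_G) auto
    moreover have "prob (B k - far k) = prob (B k) - prob (B k \<inter> far k)"
      using k by (intro finite_measure_Diff') auto
    ultimately show ?thesis by (simp add: algebra_simps)
  qed
  have "A \<inter> {\<omega> \<in> space M. \<exists>k\<in>{i<..e}. 2 * r < dist (Y i \<omega>) (Y k \<omega>)} \<subseteq> (\<Union>k\<in>{i<..e}. B k)"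
  proof safe
    fix \<omega> k assume w: "\<omega> \<in> A" "\<omega> \<in> space M" "k \<in> {i<..e}" "2 * r < dist (Y i \<omega>) (Y k \<omega>)"
    define P where "P m \<longleftrightarrow> i < m \<and> 2 * r < dist (Y i \<omega>) (Y m \<omega>)" for m
    have "P k" using w by (auto simp: P_def)
    then obtain m where m: "P m" "m \<le> k" "\<And>l. l < m \<Longrightarrow> \<not> P l"
      by (metis LeastI Least_le not_less_Least)
    then have "i < m" "2 * r < dist (Y i \<omega>) (Y m \<omega>)"
      "\<And>l. i < l \<Longrightarrow> l < m \<Longrightarrow> \<not> 2 * r < dist (Y i \<omega>) (Y l \<omega>)"
      unfolding P_def by blast+
    then have "\<omega> \<in> B m" "m \<in> {i<..e}"
      using w \<open>m \<le> k\<close> by (auto simp: B_def)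
    then show "\<omega> \<in> (\<Union>k\<in>{i<..e}. B k)" by blast
  qed
  then have "(1 - c) * prob (A \<inter> {\<omega> \<in> space M. \<exists>k\<in>{i<..e}. 2 * r < dist (Y i \<omega>) (Y k \<omega>)})
      \<le> (1 - c) * prob (\<Union>k\<in>{i<..e}. B k)"
    using c_half by (intro mult_left_mono finite_measure_mono) auto
  also have "prob (\<Union>k\<in>{i<..e}. B k) = (\<Sum>k\<in>{i<..e}. prob (B k))"
    using disj by (intro finite_measure_finite_Union) auto
  also have "(1 - c) * \<dots> = (\<Sum>k\<in>{i<..e}. (1 - c) * prob (B k))"
    by (rule sum_distrib_left)
  also have "\<dots> \<le> (\<Sum>k\<in>{i<..e}. prob (B k - far k))"
    by (intro sum_mono B_step)
  also have "\<dots> = prob (\<Union>k\<in>{i<..e}. B k - far k)"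
    using disj by (intro finite_measure_finite_Union[symmetric])
      (auto simp: disjoint_family_on_def)
  also have "\<dots> \<le> prob (A \<inter> {\<omega> \<in> space M. r < dist (Y i \<omega>) (Y e \<omega>)})"
  proof (intro finite_measure_mono subsetI)
    fix \<omega> assume "\<omega> \<in> (\<Union>k\<in>{i<..e}. B k - far k)"
    then obtain k where k: "\<omega> \<in> A" "\<omega> \<in> space M"
      "2 * r < dist (Y i \<omega>) (Y k \<omega>)" "dist (Y k \<omega>) (Y e \<omega>) \<le> r"
      by (auto simp: B_def far_def)
    moreover have "dist (Y i \<omega>) (Y k \<omega>) \<le> dist (Y i \<omega>) (Y e \<omega>) + dist (Y k \<omega>) (Y e \<omega>)"
      by (metis dist_commute dist_triangle)
    ultimately show "\<omega> \<in> A \<inter> {\<omega> \<in> space M. r < dist (Y i \<omega>) (Y e \<omega>)}" by auto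
  qed auto
  also have "\<dots> \<le> c * prob A"
    using assms by (intro step)
  finally show ?thesis .
qed

abbreviation path :: "'w \<Rightarrow> nat \<Rightarrow> 'e" where
  "path \<omega> \<equiv> \<lambda>i. Y i \<omega>"

lemma measurable_anchor_eq:
  "{\<omega> \<in> space M. anchor r (path \<omega>) i = l} \<in> sets (G i)"
proof (induction i arbitrary: l)
  case 0
  show ?case using sets.top[of "G 0"] by (cases "l = 0") (auto simp: space_G)
next
  case (Suc i)
  have IH: "{\<omega> \<in> space M. anchor r (path \<omega>) i = m} \<in> sets (G (Suc i))" for m
    using Suc.IH[of m] sets_mono[of i "Suc i"] by auto
  \<comment> \<open>The union describes a reset at \<open>Suc i\<close> from some earlier anchor,
    the other term an anchor \<open>l\<close> that survives. For \<open>l > i\<close> the latter is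
    emptied by subtracting \<open>space M\<close>, which avoids \<open>Y l\<close>, possibly not yet
    observable at \<open>Suc i\<close>.\<close>
  have "{\<omega> \<in> space M. anchor r (path \<omega>) (Suc i) = l} =
    (\<Union>m\<in>{..i}. {\<omega> \<in> space M. anchor r (path \<omega>) i = m} \<inter>
      (if l = Suc i then {\<omega> \<in> space M. 2 * r < dist (Y m \<omega>) (Y (Suc i) \<omega>)} else {}))
    \<union> ({\<omega> \<in> space M. anchor r (path \<omega>) i = l} - 
      (if l \<le> i then {\<omega> \<in> space M. 2 * r < dist (Y l \<omega>) (Y (Suc i) \<omega>)} else space M))"
    (is "?L = ?R")
  proof (intro set_eqI)
    fix \<omega>
    have "anchor r (path \<omega>) i \<le> i" by (rule anchor_le)
    then show "\<omega> \<in> ?L \<longleftrightarrow> \<omega> \<in> ?R" by (cases "l \<le> i"; cases "l = Suc i") auto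
  qed
  also have "\<dots> \<in> sets (G (Suc i))"
    using IH sets.top[of "G (Suc i)"]
    by (intro sets.Un sets.Diff sets.finite_UN sets.Int) (auto simp: space_G)
  finally show ?case .
qed

lemma measurable_card_resets [measurable]:
  "(\<lambda>\<omega>. card (resets r (path \<omega>) n)) \<in> measurable M (count_space UNIV)"
proof -
  have [measurable]: "Measurable.pred M (\<lambda>\<omega>. anchor r (path \<omega>) k = k)" for k
    using sets_G[OF measurable_anchor_eq] by (simp add: pred_def)
  have "(\<lambda>\<omega>. card (resets r (path \<omega>) n)) =
      (\<lambda>\<omega>. \<Sum>k\<le>n. of_bool (anchor r (path \<omega>) k = k))"
    by (simp add: resets_def sum_of_bool_eq Int_def)
  then show ?thesis by simp
qed

text \<open>\<open>J i\<close> is a reset at \<open>i\<close>, and \<open>W i\<close> an exit from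
  the ball of radius \<open>2 * r\<close> within time \<open>h\<close> after \<open>i\<close>.
  Resets outside \<open>W i\<close> are more than \<open>h\<close> apart, which bounds their number
  on every path. Those inside \<open>W i\<close> have probability at most
  \<open>c / (1 - c) * prob (J i)\<close>. Adding up yields a linear inequality for \<open>S\<close>
  with coefficient \<open>1 - 2 * c > 0\<close>.\<close>

lemma expectation_card_resets_le:
  assumes range: "\<And>i. 0 \<le> t i \<and> t i \<le> T"
  shows "(\<integral>\<^sup>+ \<omega>. of_nat (card (resets r (path \<omega>) n)) \<partial>M) \<le>
    ennreal ((1 - c) / (1 - 2 * c) * (T / h + 1))"
proof -
  define J where "J i = {\<omega> \<in> space M. anchor r (path \<omega>) i = i}" for i
  define W where "W i = {\<omega> \<in> space M. \<exists>k\<in>{k. i < k \<and> k \<le> n \<and> t k - t i \<le> h}.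
      2 * r < dist (Y i \<omega>) (Y k \<omega>)}" for i
  have J_G: "J i \<in> sets (G i)" for i unfolding J_def by (rule measurable_anchor_eq)
  then have J[measurable]: "J i \<in> sets M" for i using sets_G by blast
  have W[measurable]: "W i \<in> sets M" for i unfolding W_def by measurable
  have T: "0 \<le> T" using range[of 0] by linarith
  have short: "(1 - c) * prob (J i \<inter> W i) \<le> c * prob (J i)" if "i \<le> n" for i
  proof -
    \<comment> \<open>A single right endpoint for Ottaviani's inequality: it is itself within time
      \<open>h\<close> of \<open>t i\<close>, and no index that \<open>W i\<close> ranges over
      exceeds it.\<close>
    define e where "e = Max {k. i \<le> k \<and> k \<le> n \<and> t k - t i \<le> h}"
    have fin: "finite {k. i \<le> k \<and> k \<le> n \<and> t k - t i \<le> h}"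
      by (rule finite_subset[of _ "{..n}"]) auto
    have ne: "i \<in> {k. i \<le> k \<and> k \<le> n \<and> t k - t i \<le> h}" using that h_pos by simp
    have "e \<in> {k. i \<le> k \<and> k \<le> n \<and> t k - t i \<le> h}"
      unfolding e_def using fin ne by (intro Max_in) auto
    then have e: "i \<le> e" "e \<le> n" "t e - t i \<le> h" by auto
    have le_e: "k \<le> e" if "i < k" "k \<le> n" "t k - t i \<le> h" for k
      unfolding e_def using fin that by (intro Max_ge) auto
    have "prob (J i \<inter> W i)
      \<le> prob (J i \<inter> {\<omega> \<in> space M. \<exists>k\<in>{i<..e}. 2 * r < dist (Y i \<omega>) (Y k \<omega>)})"
      by (rule finite_measure_mono) (use le_e in \<open>auto simp: W_def intro!: bexI[rotated]\<close>)
    from mult_left_mono[OF this, of "1 - c"] show ?thesis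
      using ottaviani[OF e(1,3) J_G] c_half by linarith
  qed
  have long: "(\<Sum>i\<le>n. indicator (J i - W i) \<omega> :: real) \<le> T / h + 1" if "\<omega> \<in> space M" for \<omega>
  proof -
    let ?S = "{i \<in> {..n}. \<omega> \<in> J i - W i}"
    have "real (card ?S) \<le> max 0 T / h + 1"
    proof (rule card_separated_le[OF _ h_pos])
      fix i k assume ik: "i \<in> ?S" "k \<in> ?S" "i < k"
      then have "anchor r (path \<omega>) i = i" "anchor r (path \<omega>) k = k" by (auto simp: J_def)
      from exit_between_resets[OF this ik(3)] obtain m where
        m: "i < m" "m \<le> k" "2 * r < dist (Y i \<omega>) (Y m \<omega>)" by auto
      then have "h < t m - t i" using ik that by (fastforce simp: W_def not_le[symmetric])
      moreover have "t m \<le> t k" using t_mono m by (auto simp: mono_def)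
      ultimately show "h < t k - t i" by simp
    qed (use range in auto)
    then show ?thesis
      using T by (simp add: indicator_def sum_of_bool_eq Int_def)
  qed
  have card_eq: "real (card (resets r (path \<omega>) n)) = (\<Sum>i\<le>n. indicator (J i) \<omega>)"
    if "\<omega> \<in> space M" for \<omega>
    using that by (simp add: resets_def J_def indicator_def sum_of_bool_eq Int_def)
  define S where "S = (\<Sum>i\<le>n. prob (J i))"
  have "(\<Sum>i\<le>n. prob (J i - W i)) = expectation (\<lambda>\<omega>. \<Sum>i\<le>n. indicator (J i - W i) \<omega>)"
    by (simp add: integrable_real_indicator emeasure_eq_measure)
  also have "\<dots> \<le> expectation (\<lambda>\<omega>. T / h + 1)"
    by (intro integral_mono) (auto simp: long emeasure_eq_measure)
  finally have long': "(\<Sum>i\<le>n. prob (J i - W i)) \<le> T / h + 1" by (simp add: prob_space)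
  have "(1 - c) * S = (1 - c) * (\<Sum>i\<le>n. prob (J i - W i)) + (\<Sum>i\<le>n. (1 - c) * prob (J i \<inter> W i))"
  proof -
    have "prob (J i) = prob (J i - W i) + prob (J i \<inter> W i)" for i
      using finite_measure_Diff'[of "J i" "W i"] by simp
    then have "S = (\<Sum>i\<le>n. prob (J i - W i)) + (\<Sum>i\<le>n. prob (J i \<inter> W i))"
      by (simp add: S_def sum.distrib)
    then show ?thesis by (simp add: distrib_left sum_distrib_left)
  qed
  also have "\<dots> \<le> (1 - c) * (T / h + 1) + (\<Sum>i\<le>n. c * prob (J i))"
    using c_half long' by (intro add_mono mult_left_mono sum_mono short) auto
  also have "(\<Sum>i\<le>n. c * prob (J i)) = c * S" by (simp add: S_def sum_distrib_left)
  finally have "(1 - 2 * c) * S \<le> (1 - c) * (T / h + 1)" by (simp add: algebra_simps)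
  then have S: "S \<le> (1 - c) / (1 - 2 * c) * (T / h + 1)"
    using c_half by (simp add: field_simps)
  have "(\<integral>\<^sup>+ \<omega>. of_nat (card (resets r (path \<omega>) n)) \<partial>M)
      = (\<integral>\<^sup>+ \<omega>. ennreal (\<Sum>i\<le>n. indicator (J i) \<omega>) \<partial>M)"
    by (intro nn_integral_cong) (simp add: card_eq[symmetric] ennreal_of_nat_eq_real_of_nat)
  also have "\<dots> = ennreal (expectation (\<lambda>\<omega>. \<Sum>i\<le>n. indicator (J i) \<omega>))"
    by (intro nn_integral_eq_integral) (auto intro!: sum_nonneg simp: emeasure_eq_measure)
  also have "\<dots> = ennreal S" by (simp add: S_def emeasure_eq_measure)
  also have "\<dots> \<le> ennreal ((1 - c) / (1 - 2 * c) * (T / h + 1))" by (rule ennreal_leI[OF S])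
  finally show ?thesis .
qed

end

section \<open>Summation over the dyadic scales\<close>

lemma scale_sum_summable:
  fixes a b \<kappa> p T D :: real
  assumes "0 < a" "0 < \<kappa>" "0 < b" "\<kappa> < p"
  shows "summable (\<lambda>j. (4 * b * (1/2) ^ j) powr p * (D * (T / (a * (b * (1/2) ^ Suc j) powr \<kappa>) + 1)))"
proof -
  have half: "(1/2 :: real) ^ j = (1/2) powr j" for j
    by (simp add: powr_realpow)
  \<comment> \<open>Two geometric series: the part with \<open>T\<close> has ratio
    \<open>(1/2) powr (p - \<kappa>)\<close>, which is below 1 because \<open>\<kappa> < p\<close>,
    and the summand 1 gives ratio \<open>(1/2) powr p\<close>.\<close>
  have eq: "(4 * b * (1/2) ^ j) powr p * (D * (T / (a * (b * (1/2) ^ Suc j) powr \<kappa>) + 1)) =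
    (4 * b) powr p * D * T / (a * (b / 2) powr \<kappa>) * ((1/2) powr (p - \<kappa>)) ^ j
    + (4 * b) powr p * D * ((1/2) powr p) ^ j" for j
  proof -
    have 1: "(4 * b * (1/2) ^ j) powr p = (4 * b) powr p * ((1/2) powr p) ^ j"
      using assms by (subst powr_mult) (auto simp: half powr_powr powr_power mult.commute)
    have "b * (1/2) ^ Suc j = b / 2 * (1/2) ^ j" by simp
    then have 2: "(b * (1/2) ^ Suc j) powr \<kappa> = (b / 2) powr \<kappa> * ((1/2) powr \<kappa>) ^ j"
      using assms by (simp only:) (subst powr_mult, auto simp: half powr_powr powr_power mult.commute)
    have 3: "((1/2 :: real) powr p) ^ j = ((1/2) powr (p - \<kappa>)) ^ j * ((1/2) powr \<kappa>) ^ j"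
      by (simp add: power_mult_distrib[symmetric] powr_add[symmetric])
    have "((1/2 :: real) powr \<kappa>) ^ j > 0" "(b / 2) powr \<kappa> > 0" using assms by auto
    then show ?thesis unfolding 1 2 3 using assms by (simp add: field_simps)
  qed
  have "(1/2 :: real) powr q < 1" if "0 < q" for q
    using that powr_less_mono2[of q "1/2" 1] by simp
  then show ?thesis
    unfolding eq using assms by (intro summable_add summable_mult summable_geometric) auto
qed

text \<open>Markov's inequality for the random bound of \<open>sum_powr_le_resets\<close>, whose
  expectation is at most \<open>V\<close>. Since \<open>V\<close> depends only on the constants,
  \<open>C\<close> is fixed before the probability space, the process and the sample; this is the
  source of uniformity. The event \<open>B\<close> precedes \<open>m\<close> and \<open>u\<close>,
  so it serves all partitions of the sample.\<close>

lemma power_sums_tail: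
  fixes a b c \<kappa> p T K \<epsilon> :: real
  assumes "0 < a" "0 < \<kappa>" "0 < b" "c < 1/2" "\<kappa> < p" "0 \<le> T" "0 < \<epsilon>"
  obtains C where "0 \<le> C" and "\<And>(M :: 'w measure) G (Y :: nat \<Rightarrow> 'w \<Rightarrow> 'e::polish_space) t n.
    (\<And>r. 0 < r \<Longrightarrow> r \<le> b \<Longrightarrow> sampled_process M G Y t r (a * r powr \<kappa>) c) \<Longrightarrow>
    (\<And>i. 0 \<le> t i \<and> t i \<le> T) \<Longrightarrow>
    \<exists>B\<in>sets M. measure M B \<le> \<epsilon> \<and> (\<forall>\<omega>\<in>space M - B. \<forall>m u.
      (\<forall>j<m. u j \<le> u (Suc j)) \<longrightarrow> u m \<le> n \<longrightarrow> (\<forall>i k. dist (Y i \<omega>) (Y k \<omega>) \<le> K) \<longrightarrow>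
      (\<Sum>j<m. dist (Y (u j) \<omega>) (Y (u (Suc j)) \<omega>) powr p) \<le> C)"
proof -
  define w where "w j = (4 * b * (1/2) ^ j) powr p" for j
  define r where "r j = b * (1/2 :: real) ^ j" for j
  define E where "E \<rho> = (1 - c) / (1 - 2 * c) * (T / (a * \<rho> powr \<kappa>) + 1)" for \<rho>
  define V where "V = (\<Sum>j. w j * E (r (Suc j))) + K powr p * E b"
  have E: "0 \<le> E \<rho>" for \<rho> using assms by (auto simp: E_def)
  have w: "0 \<le> w j" for j by (simp add: w_def)
  have r: "0 < r j" "r j \<le> b" for j
    using assms by (auto simp: r_def mult_le_cancel_left1 power_le_one)
  have summable: "summable (\<lambda>j. w j * E (r (Suc j)))"
    unfolding w_def E_def r_def by (rule scale_sum_summable) (use assms in auto)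
  have V: "0 \<le> V" unfolding V_def using E w by (intro add_nonneg_nonneg suminf_nonneg summable) auto
  show thesis
  proof (rule that[of "V / \<epsilon>"])
    show "0 \<le> V / \<epsilon>" using V assms by simp
    fix M :: "'w measure" and G and Y :: "nat \<Rightarrow> 'w \<Rightarrow> 'e" and t n
    assume step: "\<And>r. 0 < r \<Longrightarrow> r \<le> b \<Longrightarrow> sampled_process M G Y t r (a * r powr \<kappa>) c"
      and range: "\<And>i. 0 \<le> t i \<and> t i \<le> T"
    interpret prob_space M
      using step[of b] \<open>0 < b\<close> by (auto simp: sampled_process_def)
    define N where "N \<rho> \<omega> = (of_nat (card (resets \<rho> (\<lambda>i. Y i \<omega>) n)) :: ennreal)" for \<rho> \<omega>
    have N[measurable]: "N \<rho> \<in> borel_measurable M" if "0 < \<rho>" "\<rho> \<le> b" for \<rho>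
      using sampled_process.measurable_card_resets[OF step[OF that], of n]
      unfolding N_def by measurable
    have NE: "(\<integral>\<^sup>+ \<omega>. N \<rho> \<omega> \<partial>M) \<le> ennreal (E \<rho>)" if "0 < \<rho>" "\<rho> \<le> b" for \<rho>
      using sampled_process.expectation_card_resets_le[OF step[OF that] range]
      unfolding N_def E_def .
    have Nm[measurable]: "N (r j) \<in> borel_measurable M" "N b \<in> borel_measurable M" for j
      using N r \<open>0 < b\<close> by auto
    define S where "S \<omega> = (\<Sum>j. ennreal (w j) * N (r (Suc j)) \<omega>) + ennreal (K powr p) * N b \<omega>" for \<omega>
    have S[measurable]: "S \<in> borel_measurable M" unfolding S_def by measurable
    have "(\<integral>\<^sup>+ \<omega>. S \<omega> \<partial>M) = (\<Sum>j. ennreal (w j) * (\<integral>\<^sup>+ \<omega>. N (r (Suc j)) \<omega> \<partial>M))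
        + ennreal (K powr p) * (\<integral>\<^sup>+ \<omega>. N b \<omega> \<partial>M)"
      unfolding S_def by (simp add: nn_integral_add nn_integral_suminf nn_integral_cmult)
    also have "\<dots> \<le> (\<Sum>j. ennreal (w j) * ennreal (E (r (Suc j)))) + ennreal (K powr p) * ennreal (E b)"
      using r \<open>0 < b\<close> by (intro add_mono suminf_le mult_left_mono NE) auto
    also have "\<dots> = ennreal V"
    proof -
      have "(\<Sum>j. ennreal (w j) * ennreal (E (r (Suc j)))) = ennreal (\<Sum>j. w j * E (r (Suc j)))"
        using summable E w by (simp add: ennreal_mult[symmetric] suminf_ennreal2)
      then show ?thesis
        unfolding V_def using summable E w
        by (subst ennreal_plus) (auto simp: ennreal_mult intro!: suminf_nonneg)
    qed
    finally have ES: "(\<integral>\<^sup>+ \<omega>. S \<omega> \<partial>M) \<le> ennreal V" .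
    define B where "B = {\<omega> \<in> space M. ennreal (V / \<epsilon>) < S \<omega>}"
    have B[measurable]: "B \<in> sets M" unfolding B_def by measurable
    have "ennreal (V / \<epsilon>) * emeasure M B \<le> ennreal V"
    proof -
      have "ennreal (V / \<epsilon>) * emeasure M B = (\<integral>\<^sup>+ \<omega>. ennreal (V / \<epsilon>) * indicator B \<omega> \<partial>M)"
        by (simp add: nn_integral_cmult_indicator)
      also have "\<dots> \<le> (\<integral>\<^sup>+ \<omega>. S \<omega> \<partial>M)"
        by (intro nn_integral_mono) (auto simp: B_def indicator_def)
      finally show ?thesis using ES by simp
    qed
    then have le: "V / \<epsilon> * prob B \<le> V"
      using V assms by (simp add: emeasure_eq_measure ennreal_mult[symmetric])
    have "prob B \<le> \<epsilon>"
    \<comment> \<open>The product form \<open>le\<close> of Markov's inequality says nothing for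
      \<open>V = 0\<close>; in that case \<open>S\<close> vanishes almost everywhere and
      \<open>B\<close> is null.\<close>
    proof (cases "V = 0")
      case True
      then have "(\<integral>\<^sup>+ \<omega>. S \<omega> \<partial>M) = 0" using ES by simp
      then have "AE \<omega> in M. S \<omega> = 0" by (subst (asm) nn_integral_0_iff_AE) auto
      then have "AE \<omega> in M. \<omega> \<notin> B" by eventually_elim (simp add: B_def True)
      then have "prob B = 0" by (subst prob_eq_0) auto
      then show ?thesis using assms by simp
    qed (use le V assms in \<open>simp add: field_simps\<close>)
    moreover have "(\<Sum>j<m. dist (Y (u j) \<omega>) (Y (u (Suc j)) \<omega>) powr p) \<le> V / \<epsilon>"
      if "\<omega> \<in> space M - B" "\<forall>j<m. u j \<le> u (Suc j)" "u m \<le> n" "\<forall>i k. dist (Y i \<omega>) (Y k \<omega>) \<le> K"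
      for \<omega> m u
    proof -
      have "ennreal (\<Sum>j<m. dist (Y (u j) \<omega>) (Y (u (Suc j)) \<omega>) powr p) \<le> S \<omega>"
        unfolding S_def w_def N_def r_def
        using sum_powr_le_resets[of b p m u n "\<lambda>i. Y i \<omega>" K] that assms by simp
      also have "\<dots> \<le> ennreal (V / \<epsilon>)" using that by (auto simp: B_def not_less)
      finally show ?thesis using V assms by (subst (asm) ennreal_le_iff) auto
    qed
    ultimately show "\<exists>B\<in>sets M. prob B \<le> \<epsilon> \<and> (\<forall>\<omega>\<in>space M - B. \<forall>m u.
      (\<forall>j<m. u j \<le> u (Suc j)) \<longrightarrow> u m \<le> n \<longrightarrow> (\<forall>i k. dist (Y i \<omega>) (Y k \<omega>) \<le> K) \<longrightarrow>
      (\<Sum>j<m. dist (Y (u j) \<omega>) (Y (u (Suc j)) \<omega>) powr p) \<le> V / \<epsilon>)"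
      using B by blast
  qed
qed

section \<open>The Markov property at deterministic times\<close>

text \<open>Take the Markov property at the initial time \<open>s\<close> and integrate it. As
  \<open>\<omega> s = x\<close> almost surely, the conditional probability is a constant.\<close>

lemma markov_law_marginal:
  assumes law: "markov_law T Q s x P" and "s \<le> t" "t \<le> T" and B: "B \<in> sets borel"
  shows "measure P {\<omega> \<in> space P. \<omega> t \<in> B} = measure (Q s t x) B"
proof -
  interpret prob_space P using law by (simp add: markov_law_def)
  define F where "F = vimage_algebra (space P) (\<lambda>\<omega>. restrict \<omega> {s..s}) (Pi\<^sub>M {s..s} (\<lambda>_. borel :: 'a measure))"
  have sets_P[measurable_cong]: "sets P = sets (Pi\<^sub>M {s..T} (\<lambda>_. borel))"
    using law by (simp add: markov_law_def)
  have "(\<lambda>\<omega>. restrict \<omega> {s..s}) \<in> P \<rightarrow>\<^sub>M Pi\<^sub>M {s..s} (\<lambda>_. borel)"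
    unfolding measurable_cong_sets[OF sets_P refl]
    using assms by (intro measurable_restrict_subset) auto
  then have "subalgebra P F"
    unfolding subalgebra_def F_def by (simp add: sets_image_in_sets)
  then interpret finite_measure_subalgebra P F by unfold_locales
  have "(\<lambda>\<omega>. \<omega> t) \<in> P \<rightarrow>\<^sub>M borel"
    unfolding measurable_cong_sets[OF sets_P refl]
    using assms by (intro measurable_component_singleton) auto
  then have S: "{\<omega> \<in> space P. \<omega> t \<in> B} \<in> sets P" using B by measurable
  have "AE \<omega> in P. real_cond_exp P F (indicator {\<omega> \<in> space P. \<omega> t \<in> B}) \<omega> = measure (Q s t (\<omega> s)) B"
    using law[unfolded markov_law_def, THEN conjunct2, THEN conjunct2, THEN conjunct2,
        rule_format, of s t B] assms unfolding F_def by simp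
  moreover have "AE \<omega> in P. \<omega> s = x" using law by (simp add: markov_law_def)
  ultimately have "AE \<omega> in P. real_cond_exp P F (indicator {\<omega> \<in> space P. \<omega> t \<in> B}) \<omega>
      = measure (Q s t x) B"
    by eventually_elim simp
  then have "(\<integral>\<omega>. real_cond_exp P F (indicator {\<omega> \<in> space P. \<omega> t \<in> B}) \<omega> \<partial>P)
      = (\<integral>\<omega>. measure (Q s t x) B \<partial>P)"
    by (intro integral_cong_AE) auto
  moreover have "(\<integral>\<omega>. real_cond_exp P F (indicator {\<omega> \<in> space P. \<omega> t \<in> B}) \<omega> \<partial>P)
      = prob {\<omega> \<in> space P. \<omega> t \<in> B}"
    using S by (subst real_cond_exp_int(2)) (auto simp: emeasure_eq_measure Int_absorb1)
  ultimately show ?thesis by (simp add: prob_space)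
qed

text \<open>Hypothesis (b) concerns the laws on path space, whereas the strong Markov property of
  the process speaks of its transition probabilities; this carries the bound from one to the
  other.\<close>

lemma markov_law_transition_le:
  fixes Q :: "real \<Rightarrow> real \<Rightarrow> 'e::polish_space \<Rightarrow> 'e measure"
  assumes law: "markov_law T Q s x P" and "s \<le> t" "t \<le> T"
    and le: "\<P>(\<omega> in P. \<delta> < dist (\<omega> s) (\<omega> t)) \<le> c"
  shows "measure (Q s t x) {y. \<delta> < dist x y} \<le> c"
proof -
  interpret prob_space P using law by (simp add: markov_law_def)
  have sets_P: "sets P = sets (Pi\<^sub>M {s..T} (\<lambda>_. borel))"
    using law by (simp add: markov_law_def)
  have [measurable]: "(\<lambda>\<omega>. \<omega> u) \<in> P \<rightarrow>\<^sub>M borel" if "u \<in> {s..T}" for u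
    unfolding measurable_cong_sets[OF sets_P refl]
    using that by (intro measurable_component_singleton) auto
  have [measurable]: "(\<lambda>\<omega>. \<omega> t) \<in> P \<rightarrow>\<^sub>M borel" "(\<lambda>\<omega>. \<omega> s) \<in> P \<rightarrow>\<^sub>M borel"
    using assms by auto
  have [measurable]: "{y. \<delta> < dist x y} \<in> sets borel" by measurable
  have start: "AE \<omega> in P. \<omega> s = x" using law by (simp add: markov_law_def)
  have "measure (Q s t x) {y. \<delta> < dist x y} = prob {\<omega> \<in> space P. \<omega> t \<in> {y. \<delta> < dist x y}}"
    by (rule markov_law_marginal[OF law \<open>s \<le> t\<close> \<open>t \<le> T\<close>, symmetric]) measurable
  also have "\<dots> = \<P>(\<omega> in P. \<delta> < dist (\<omega> s) (\<omega> t))"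
    by (intro measure_eq_AE) (use start in \<open>auto elim: eventually_mono\<close>)
  finally show ?thesis using le by simp
qed

lemma cadlag_strong_markovD:
  assumes "cadlag_strong_markov T Z"
  shows "prob_space (mp_space Z)" "filtration (space (mp_space Z)) (mp_filt Z)"
    "subalgebra (mp_space Z) (mp_filt Z t)"
    "t \<in> {0..T} \<Longrightarrow> mp_val Z t \<in> borel_measurable (mp_filt Z t)"
    "\<omega> \<in> space (mp_space Z) \<Longrightarrow> cadlag_on T (\<lambda>t. mp_val Z t \<omega>)"
    "s \<in> {0..T} \<Longrightarrow> markov_law T (mp_trans Z) s x (mp_law Z s x)"
    "\<lbrakk>stopping_time (mp_filt Z) \<tau>; \<And>\<omega>. \<omega> \<in> space (mp_space Z) \<Longrightarrow> \<tau> \<omega> \<in> {0..T}; 0 \<le> u; B \<in> sets borel\<rbrakk> \<Longrightarrow>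
      AE \<omega> in mp_space Z.
        real_cond_exp (mp_space Z) (filtration.pre_sigma (space (mp_space Z)) (mp_filt Z) \<tau>)
          (indicator {\<omega>\<in>space (mp_space Z). \<tau> \<omega> + u \<le> T \<and> mp_val Z (\<tau> \<omega> + u) \<omega> \<in> B}) \<omega>
        = indicator {\<omega>. \<tau> \<omega> + u \<le> T} \<omega>
            * measure (mp_trans Z (\<tau> \<omega>) (\<tau> \<omega> + u) (mp_val Z (\<tau> \<omega>) \<omega>)) B"
  using assms unfolding cadlag_strong_markov_def Let_def by blast+

lemma cadlag_strong_markov_measurable:
  assumes "cadlag_strong_markov T Z" "t \<in> {0..T}"
  shows "mp_val Z t \<in> borel_measurable (mp_space Z)"
  using cadlag_strong_markovD(3,4)[OF assms(1)] assms(2) by (blast intro: measurable_from_subalg)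

text \<open>The strong Markov property for the constant stopping time \<open>s\<close> and the
  increment \<open>t - s\<close>, integrated over \<open>A\<close>. The pre-sigma-algebra of a
  constant time contains the events of \<open>mp_filt Z s\<close>, so \<open>A\<close> is
  admissible.\<close>

lemma markov_property_le:
  fixes Z :: "('w, 'e::polish_space) markov_process"
  assumes Z: "cadlag_strong_markov T Z" and st: "0 \<le> s" "s \<le> t" "t \<le> T"
    and A: "A \<in> sets (mp_filt Z s)" and B: "B \<in> sets borel"
    and le: "\<And>\<omega>. \<omega> \<in> A \<Longrightarrow> measure (mp_trans Z s t (mp_val Z s \<omega>)) B \<le> c"
  shows "measure (mp_space Z) (A \<inter> {\<omega> \<in> space (mp_space Z). mp_val Z t \<omega> \<in> B})
    \<le> c * measure (mp_space Z) A"
proof -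
  note D = cadlag_strong_markovD[OF Z]
  interpret prob_space "mp_space Z" by (rule D)
  interpret F: filtration "space (mp_space Z)" "mp_filt Z" by (rule D)
  have X[measurable]: "mp_val Z t \<in> borel_measurable (mp_space Z)"
    using st by (intro cadlag_strong_markov_measurable[OF Z]) auto
  let ?G = "F.pre_sigma (\<lambda>_. s)"
  have const: "stopping_time (mp_filt Z) (\<lambda>_. s)" by (rule stopping_time_const)
  have A_G: "A \<in> sets ?G"
  proof (rule F.sets_pre_sigmaI[OF const])
    fix u show "{\<omega> \<in> A. s \<le> u} \<in> sets (mp_filt Z u)"
      using A F.sets_F_mono[of s u] by (cases "s \<le> u") auto
  qed
  have "sets ?G \<subseteq> sets (mp_space Z)"
  proof
    fix A' assume "A' \<in> sets ?G"
    then have "{\<omega> \<in> A'. s \<le> s} \<in> sets (mp_filt Z s)" by (rule F.sets_pre_sigmaD[OF const])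
    then show "A' \<in> sets (mp_space Z)" using D(3)[of s] by (auto simp: subalgebra_def)
  qed
  then have "subalgebra (mp_space Z) ?G"
    by (simp add: subalgebra_def F.space_pre_sigma)
  then interpret finite_measure_subalgebra "mp_space Z" ?G by unfold_locales
  have A_M[measurable]: "A \<in> sets (mp_space Z)"
    using A D(3)[of s] by (auto simp: subalgebra_def)
  let ?S = "{\<omega> \<in> space (mp_space Z). mp_val Z t \<omega> \<in> B}"
  have S[measurable]: "?S \<in> sets (mp_space Z)" using B by measurable
  have AE: "AE \<omega> in mp_space Z. real_cond_exp (mp_space Z) ?G (indicator ?S) \<omega>
      = measure (mp_trans Z s t (mp_val Z s \<omega>)) B"
    using D(7)[OF const, of "t - s" B] st B by simp
  have int: "integrable (mp_space Z) (indicator ?S :: _ \<Rightarrow> real)"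
    by (simp add: emeasure_eq_measure)
  have "prob (A \<inter> ?S) = (\<integral>\<omega>. indicator A \<omega> * indicator ?S \<omega> \<partial>mp_space Z)"
    by (simp add: indicator_inter_arith[symmetric] Int_absorb1)
  also have "\<dots> = (\<integral>\<omega>. indicator A \<omega> * real_cond_exp (mp_space Z) ?G (indicator ?S) \<omega> \<partial>mp_space Z)"
    using real_cond_exp_intA[OF int A_G] by (simp add: set_lebesgue_integral_def)
  also have "\<dots> \<le> (\<integral>\<omega>. c * indicator A \<omega> \<partial>mp_space Z)"
  proof (rule integral_mono_AE)
    show "integrable (mp_space Z) (\<lambda>\<omega>. indicator A \<omega> * real_cond_exp (mp_space Z) ?G (indicator ?S) \<omega>)"
      using integrable_mult_indicator[OF A_M real_cond_exp_int(1)[OF int]] by simp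
    show "AE \<omega> in mp_space Z. indicator A \<omega> * real_cond_exp (mp_space Z) ?G (indicator ?S) \<omega>
      \<le> c * indicator A \<omega>"
      using AE by eventually_elim (auto simp: indicator_def le)
  qed (simp add: emeasure_eq_measure)
  also have "\<dots> = c * prob A" by simp
  finally show ?thesis .
qed

text \<open>Conditionally on \<open>F\<^sub>s\<close> the Markov property controls the event \<open>X\<^sub>t \<in> B\<close> only for a fixed set
  \<open>B\<close>. Localizing \<open>X\<^sub>s\<close> in countably many balls of radius \<open>\<delta>\<close> costs a factor 3 in the threshold.\<close>

lemma markov_step_le:
  fixes Z :: "('w, 'e::polish_space) markov_process"
  assumes Z: "cadlag_strong_markov T Z" and st: "0 \<le> s" "s \<le> t" "t \<le> T"
    and A: "A \<in> sets (mp_filt Z s)" and "0 < \<delta>"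
    and le: "\<And>x. measure (mp_trans Z s t x) {y. \<delta> < dist x y} \<le> c"
    and prob: "\<And>x. prob_space (mp_trans Z s t x)" "\<And>x. sets (mp_trans Z s t x) = sets borel"
  shows "measure (mp_space Z) (A \<inter> {\<omega> \<in> space (mp_space Z). 3 * \<delta> < dist (mp_val Z s \<omega>) (mp_val Z t \<omega>)})
    \<le> c * measure (mp_space Z) A"
proof -
  note D = cadlag_strong_markovD[OF Z]
  interpret prob_space "mp_space Z" by (rule D)
  let ?X = "mp_val Z"
  have [measurable]: "?X s \<in> borel_measurable (mp_filt Z s)" using st by (intro D) auto
  have [measurable]: "?X s \<in> borel_measurable (mp_space Z)" "?X t \<in> borel_measurable (mp_space Z)"
    using st by (auto intro!: cadlag_strong_markov_measurable[OF Z])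
  have space_F: "space (mp_filt Z s) = space (mp_space Z)"
    and F_M: "\<And>A. A \<in> sets (mp_filt Z s) \<Longrightarrow> A \<in> sets (mp_space Z)"
    using D(3)[of s] by (auto simp: subalgebra_def)
  have A_space: "A \<subseteq> space (mp_space Z)" using sets.sets_into_space[OF A] space_F by simp
  obtain E :: "'e set" where E: "countable E" "\<And>X. open X \<Longrightarrow> X \<noteq> {} \<Longrightarrow> \<exists>d\<in>E. d \<in> X"
    using countable_dense_setE by blast
  then have "E \<noteq> {}" using open_UNIV by blast
  define e where "e = from_nat_into E"
  have e: "\<exists>i. x \<in> ball (e i) \<delta>" for x
  proof -
    obtain d where "d \<in> E" "d \<in> ball x \<delta>" using E(2)[of "ball x \<delta>"] \<open>0 < \<delta>\<close> by auto
    moreover obtain i where "e i = d"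
      unfolding e_def using from_nat_into_surj[OF E(1) \<open>d \<in> E\<close>] by auto
    ultimately show ?thesis by (auto simp: dist_commute)
  qed
  define D where "D = disjointed (\<lambda>i. ball (e i) \<delta>)"
  have D_borel[measurable]: "D i \<in> sets borel" for i
  proof -
    have "range D \<subseteq> sets borel" unfolding D_def by (rule sets.range_disjointed_sets) auto
    then show ?thesis by auto
  qed
  have D_UN: "(\<Union>i. D i) = UNIV" unfolding D_def UN_disjointed_eq using e by auto
  have D_disj: "disjoint_family D" unfolding D_def by (rule disjoint_family_disjointed)
  define A' where "A' i = A \<inter> {\<omega> \<in> space (mp_space Z). ?X s \<omega> \<in> D i}" for i
  have A'_F: "A' i \<in> sets (mp_filt Z s)" for i
  proof -
    have "{\<omega> \<in> space (mp_filt Z s). ?X s \<omega> \<in> D i} \<in> sets (mp_filt Z s)" by measurable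
    then show ?thesis unfolding A'_def space_F using A by auto
  qed
  then have A'[measurable]: "A' i \<in> sets (mp_space Z)" for i using F_M by blast
  have A_eq: "A = (\<Union>i. A' i)" using D_UN A_space by (auto simp: A'_def)
  have A'_disj: "disjoint_family A'"
    using D_disj by (auto simp: A'_def disjoint_family_on_def)
  \<comment> \<open>On \<open>A' i\<close> the value at \<open>s\<close> is within \<delta> of the
    centre \<open>e i\<close>. A displacement above \<open>3 * \<delta>\<close> therefore puts the
    value at \<open>t\<close> into this fixed set, and a point of the set is further than \<delta>
    from the value at \<open>s\<close>.\<close>
  define S where "S i = A' i \<inter> {\<omega> \<in> space (mp_space Z). ?X t \<omega> \<in> {y. 2 * \<delta> < dist (e i) y}}" for i
  have S[measurable]: "S i \<in> sets (mp_space Z)" for i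
    unfolding S_def by measurable
  have near: "dist (e i) (?X s \<omega>) < \<delta>" if "\<omega> \<in> A' i" for i \<omega>
    using that disjointed_subset[of "\<lambda>i. ball (e i) \<delta>" i] by (auto simp: A'_def D_def)
  have S_le: "prob (S i) \<le> c * prob (A' i)" for i
    unfolding S_def
  proof (rule markov_property_le[OF Z st A'_F])
    fix \<omega> assume "\<omega> \<in> A' i"
    have "\<delta> < dist (?X s \<omega>) y" if "2 * \<delta> < dist (e i) y" for y
      using near[OF \<open>\<omega> \<in> A' i\<close>] dist_triangle[of "e i" y "?X s \<omega>"] that by linarith
    then have "measure (mp_trans Z s t (?X s \<omega>)) {y. 2 * \<delta> < dist (e i) y}
      \<le> measure (mp_trans Z s t (?X s \<omega>)) {y. \<delta> < dist (?X s \<omega>) y}"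
      by (intro finite_measure.finite_measure_mono prob_space.finite_measure prob(1)) (auto simp: prob(2))
    then show "measure (mp_trans Z s t (?X s \<omega>)) {y. 2 * \<delta> < dist (e i) y} \<le> c"
      using le order_trans by blast
  qed measurable
  have sums: "(\<lambda>i. prob (A' i)) sums prob A"
    unfolding A_eq using A'_disj by (intro finite_measure_UNION) auto
  then have sum_c: "(\<lambda>i. c * prob (A' i)) sums (c * prob A)" by (rule sums_mult)
  have summ: "summable (\<lambda>i. prob (S i))"
    by (rule summable_comparison_test'[OF sums_summable[OF sum_c], of 0]) (simp add: S_le)
  have "A \<inter> {\<omega> \<in> space (mp_space Z). 3 * \<delta> < dist (?X s \<omega>) (?X t \<omega>)} \<subseteq> (\<Union>i. S i)"
  proof
    fix \<omega> assume w: "\<omega> \<in> A \<inter> {\<omega> \<in> space (mp_space Z). 3 * \<delta> < dist (?X s \<omega>) (?X t \<omega>)}"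
    then obtain i where i: "\<omega> \<in> A' i" using A_eq by blast
    have "dist (?X s \<omega>) (?X t \<omega>) \<le> dist (e i) (?X s \<omega>) + dist (e i) (?X t \<omega>)"
      by (rule dist_triangle3)
    then show "\<omega> \<in> (\<Union>i. S i)" using w i near[OF i] by (force simp: S_def)
  qed
  then have "prob (A \<inter> {\<omega> \<in> space (mp_space Z). 3 * \<delta> < dist (?X s \<omega>) (?X t \<omega>)}) \<le> prob (\<Union>i. S i)"
    by (rule finite_measure_mono) auto
  also have "\<dots> \<le> (\<Sum>i. prob (S i))"
    by (rule finite_measure_subadditive_countably) (use summ in auto)
  also have "\<dots> \<le> (\<Sum>i. c * prob (A' i))"
    by (intro suminf_le S_le summ sums_summable[OF sum_c])
  also have "\<dots> = c * prob A" using sums_unique[OF sum_c] by simp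
  finally show ?thesis .
qed

section \<open>Cadlag paths and rational partitions\<close>

text \<open>Boundedness is additive over adjacent intervals, so by Bolzano's argument it suffices
  near each point. There the one-sided limits bound the path on punctured one-sided neighbourhoods,
  and the point itself adds one value. Intersecting with \<open>{0..T}\<close> makes the outer
  neighbourhoods at the endpoints empty.\<close>

lemma cadlag_on_bounded:
  fixes x :: "real \<Rightarrow> 'e::metric_space"
  assumes x: "cadlag_on T x" and "0 \<le> T"
  shows "bounded (x ` {0..T})"
proof -
  have near: "\<exists>P. eventually P F \<and> bounded (x ` Collect P)" if "(x \<longlongrightarrow> l) F" for l and F :: "real filter"
    using tendstoD[OF that zero_less_one]
    by (intro exI[of _ "\<lambda>z. dist (x z) l < 1"])
      (auto simp: bounded_def dist_commute intro!: exI[of _ l] exI[of _ 1])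
  have "bounded (x ` ({0..T} \<inter> {0..T}))"
  proof (induction rule: Bolzano[OF \<open>0 \<le> T\<close>, of "\<lambda>u v. bounded (x ` ({u..v} \<inter> {0..T}))"])
    case (1 a b c)
    then have "{a..c} \<inter> {0..T} = ({a..b} \<inter> {0..T}) \<union> ({b..c} \<inter> {0..T})" by auto
    then show ?case using 1 by (simp add: image_Un)
  next
    case (2 y)
    have "\<exists>b>y. bounded (x ` ({y<..<b} \<inter> {0..T}))"
    proof (cases "y < T")
      case True
      then have l: "(x \<longlongrightarrow> x y) (at_right y)"
        using x 2 by (simp add: cadlag_on_def)
      obtain P where P: "eventually P (at_right y)" "bounded (x ` Collect P)"
        using near[OF l] by auto
      with P(1) obtain b where "b > y" "\<And>z. y < z \<Longrightarrow> z < b \<Longrightarrow> P z"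
        unfolding eventually_at_right_field by blast
      then show ?thesis by (intro exI[of _ b] conjI bounded_subset[OF P(2)] image_mono) auto
    next
      case False
      then have "{y<..<y + 1} \<inter> {0..T} = {}" by auto
      then show ?thesis by (intro exI[of _ "y + 1"]) simp
    qed
    then obtain b where b: "b > y" "bounded (x ` ({y<..<b} \<inter> {0..T}))" by blast
    have "\<exists>a<y. bounded (x ` ({a<..<y} \<inter> {0..T}))"
    proof (cases "0 < y")
      case True
      then have "\<exists>l. (x \<longlongrightarrow> l) (at_left y)"
        using x 2 by (simp add: cadlag_on_def)
      then obtain l where l: "(x \<longlongrightarrow> l) (at_left y)" ..
      obtain P where P: "eventually P (at_left y)" "bounded (x ` Collect P)"
        using near[OF l] by auto
      with P(1) obtain a where "a < y" "\<And>z. a < z \<Longrightarrow> z < y \<Longrightarrow> P z"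
        unfolding eventually_at_left_field by blast
      then show ?thesis by (intro exI[of _ a] conjI bounded_subset[OF P(2)] image_mono) auto
    next
      case False
      then have "{y - 1<..<y} \<inter> {0..T} = {}" by auto
      then show ?thesis by (intro exI[of _ "y - 1"]) simp
    qed
    then obtain a where a: "a < y" "bounded (x ` ({a<..<y} \<inter> {0..T}))" by blast
    have bd: "bounded (insert (x y) (x ` ({a<..<y} \<inter> {0..T}) \<union> x ` ({y<..<b} \<inter> {0..T})))"
      using a b by simp
    show ?case
    proof (intro exI conjI allI impI)
      show "0 < min (y - a) (b - y)" using a b by simp
      fix u v assume "u \<le> y \<and> y \<le> v \<and> v - u < min (y - a) (b - y)"
      then have "a < u" "v < b" by auto
      then have "{u..v} \<inter> {0..T} \<subseteq> insert y (({a<..<y} \<inter> {0..T}) \<union> ({y<..<b} \<inter> {0..T}))"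
        by auto
      from image_mono[OF this, of x] show "bounded (x ` ({u..v} \<inter> {0..T}))"
        by (intro bounded_subset[OF bd]) (simp add: image_Un)
    qed
  qed
  then show ?thesis by simp
qed

text \<open>\<open>max_osc\<close> is a real supremum and dominates its members only when they are
  bounded above, which the diameter of the path provides.\<close>

lemma dist_le_max_osc:
  assumes "cadlag_on T x" "s \<in> {0..T}" "t \<in> {0..T}"
  shows "dist (x s) (x t) \<le> max_osc T x"
proof -
  have "bounded (x ` {0..T})" using assms by (intro cadlag_on_bounded) auto
  then have "bdd_above ((\<lambda>(s, t). dist (x t) (x s)) ` ({0..T} \<times> {0..T}))"
    by (intro bdd_aboveI[of _ "diameter (x ` {0..T})"]) (auto intro: diameter_bounded_bound)
  then show ?thesis
    unfolding max_osc_def using assms by (intro cSUP_upper2[of _ _ "(t, s)"]) auto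
qed

lemma partitions_mono:
  assumes "(n, t) \<in> partitions T" "i \<le> j" "j \<le> n"
  shows "t i \<le> t j"
  using assms(2,3)
proof (induction j rule: dec_induct)
  case (step m)
  then have "t m < t (Suc m)" using assms(1) by (auto simp: partitions_def)
  then show ?case using step by simp
qed simp

lemma partitions_range:
  assumes "(n, t) \<in> partitions T" "j \<le> n"
  shows "t j \<in> {0..T}"
  using partitions_mono[OF assms(1), of 0 j] partitions_mono[OF assms(1), of j n] assms
  by (auto simp: partitions_def)

definition rational_partitions :: "real \<Rightarrow> (nat \<times> (nat \<Rightarrow> real)) set" where
  "rational_partitions T =
    {(n, t) \<in> partitions T. (\<forall>j. t j \<in> insert T \<rat>) \<and> (\<forall>j>n. t j = T)}"

lemma countable_rational_partitions: "countable (rational_partitions T)"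
proof (rule countable_subset)
  show "rational_partitions T \<subseteq>
    (\<lambda>l. (length l - 1, \<lambda>j. if j < length l then l ! j else T)) ` lists (insert T \<rat>)"
  proof
    fix \<pi> assume "\<pi> \<in> rational_partitions T"
    then obtain n t where \<pi>: "\<pi> = (n, t)" "\<forall>j. t j \<in> insert T \<rat>" "\<forall>j>n. t j = T"
      by (auto simp: rational_partitions_def)
    then have "\<pi> = (length (map t [0..<Suc n]) - 1,
        \<lambda>j. if j < length (map t [0..<Suc n]) then map t [0..<Suc n] ! j else T)"
      by (auto simp: fun_eq_iff simp del: upt_Suc)
    moreover have "map t [0..<Suc n] \<in> lists (insert T \<rat>)" using \<pi> by auto
    ultimately show "\<pi> \<in> (\<lambda>l. (length l - 1, \<lambda>j. if j < length l then l ! j else T)) ` lists (insert T \<rat>)"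
      by (rule image_eqI)
  qed
qed (auto simp: countable_rat)

lemma rational_partitions_subset: "rational_partitions T \<subseteq> partitions T"
  by (auto simp: rational_partitions_def)

lemma rational_partitions_nonempty:
  assumes "0 < T" shows "rational_partitions T \<noteq> {}"
proof -
  have "(1, \<lambda>j. if j = 0 then 0 else T) \<in> rational_partitions T"
    using assms by (auto simp: rational_partitions_def partitions_def)
  then show ?thesis by blast
qed

lemma rational_approx_right:
  fixes t T :: real
  assumes "t < T"
  obtains q :: "nat \<Rightarrow> real" where "\<And>k. q k \<in> insert T \<rat>"
    "filterlim q (at_right t) sequentially"
proof -
  \<comment> \<open>Floor plus one, unlike the ceiling, lies strictly to the right even if
    \<open>real (Suc k) * t\<close> is an integer; only limits from the right are available.\<close>
  define q where "q k = min T ((of_int \<lfloor>real (Suc k) * t\<rfloor> + 1) / real (Suc k))" for k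
  have gt: "t < q k" for k
    using assms by (auto simp: q_def less_divide_eq mult.commute simp del: of_nat_Suc)
  have le: "q k \<le> t + 1 / real (Suc k)" for k
  proof -
    have "(of_int \<lfloor>real (Suc k) * t\<rfloor> + 1) / real (Suc k) \<le> (real (Suc k) * t + 1) / real (Suc k)"
      by (intro divide_right_mono) auto
    also have "\<dots> = t + 1 / real (Suc k)" by (simp add: add_divide_distrib del: of_nat_Suc)
    finally show ?thesis by (simp add: q_def)
  qed
  have "q \<longlonglongrightarrow> t"
  proof (rule tendsto_sandwich[of "\<lambda>_. t" q sequentially "\<lambda>k. t + 1 / real (Suc k)"])
    show "(\<lambda>k. t + 1 / real (Suc k)) \<longlonglongrightarrow> t"
      using tendsto_add[OF tendsto_const LIMSEQ_Suc[OF lim_const_over_n[of 1]], of t] by simp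
  qed (use gt le in \<open>auto intro!: always_eventually less_imp_le\<close>)
  then have "filterlim q (at_right t) sequentially"
    using gt by (intro tendsto_imp_filterlim_at_right) auto
  moreover have "q k \<in> insert T \<rat>" for k
    by (auto simp: q_def min_def)
  ultimately show ?thesis using that by blast
qed

definition part_value :: "real \<Rightarrow> (real \<Rightarrow> 'e::metric_space) \<Rightarrow> nat \<times> (nat \<Rightarrow> real) \<Rightarrow> ennreal" where
  "part_value p x = (\<lambda>(n, t). ennreal ((\<Sum>j<n. dist (x (t j)) (x (t (Suc j))) powr p) powr (1 / p)))"

lemma pvar_eq_SUP_rational:
  assumes x: "cadlag_on T x" and "0 < p"
  shows "pvar p T x = (SUP \<pi>\<in>rational_partitions T. part_value p x \<pi>)"
proof (rule antisym)
  show "(SUP \<pi>\<in>rational_partitions T. part_value p x \<pi>) \<le> pvar p T x"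
    unfolding pvar_def part_value_def using rational_partitions_subset by (rule SUP_subset_mono) simp
  show "pvar p T x \<le> (SUP \<pi>\<in>rational_partitions T. part_value p x \<pi>)"
    unfolding pvar_def
  proof (safe intro!: SUP_least)
    fix n t assume nt: "(n, t) \<in> partitions T"
    then have t: "t 0 = 0" "t n = T" "\<And>j. j < n \<Longrightarrow> t j < t (Suc j)" by (auto simp: partitions_def)
    have range: "0 \<le> t j" "t j \<le> T" if "j \<le> n" for j using partitions_range[OF nt that] by auto
    have lt: "t j < T" if "j < n" for j using t(3)[of j] range(2)[of "Suc j"] that by simp
    have "\<exists>q. (\<forall>k. q k \<in> insert T \<rat>) \<and> q \<longlonglongrightarrow> t j \<and> (\<lambda>k. x (q k)) \<longlonglongrightarrow> x (t j)"
      if j: "0 < j" "j < n" for j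
    proof -
      obtain q :: "nat \<Rightarrow> real" where q: "\<And>k. q k \<in> insert T \<rat>" "filterlim q (at_right (t j)) sequentially"
        using rational_approx_right[OF lt[OF j(2)]] by metis
      have "(x \<longlongrightarrow> x (t j)) (at_right (t j))"
        using x lt[of j] range[of j] j by (auto simp: cadlag_on_def)
      from filterlim_compose[OF this q(2)] have "(\<lambda>k. x (q k)) \<longlonglongrightarrow> x (t j)" .
      moreover have "q \<longlonglongrightarrow> t j" using q(2) by (simp add: filterlim_at)
      ultimately show ?thesis using q(1) by blast
    qed
    then have "\<forall>j\<in>{0<..<n}. \<exists>q. (\<forall>k. q k \<in> insert T \<rat>) \<and> q \<longlonglongrightarrow> t j \<and> (\<lambda>k. x (q k)) \<longlonglongrightarrow> x (t j)"
      by simp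
    from bchoice[OF this] obtain q' where q': "\<And>j. j \<in> {0<..<n} \<Longrightarrow>
        (\<forall>k. q' j k \<in> insert T \<rat>) \<and> q' j \<longlonglongrightarrow> t j \<and> (\<lambda>k. x (q' j k)) \<longlonglongrightarrow> x (t j)"
      by blast
    define q where "q j = (if j = 0 then \<lambda>_. 0 else if n \<le> j then \<lambda>_. T else q' j)" for j
    have q: "q j k \<in> insert T \<rat>" "q 0 k = 0" "n \<le> j \<Longrightarrow> q j k = T" for j k
      using q'[of j] t(1,2) by (auto simp: q_def)
    have q_lim: "q j \<longlonglongrightarrow> t j" "(\<lambda>k. x (q j k)) \<longlonglongrightarrow> x (t j)" if "j \<le> n" for j
      using q'[of j] t(1,2) that by (cases "j = 0"; cases "j = n"; simp add: q_def)+
    have "\<forall>\<^sub>F k in sequentially. \<forall>j\<in>{..<n}. q j k < q (Suc j) k"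
    proof (intro eventually_ball_finite ballI)
      fix j assume j: "j \<in> {..<n}"
      then have "(\<lambda>k. q (Suc j) k - q j k) \<longlonglongrightarrow> t (Suc j) - t j"
        by (intro tendsto_diff q_lim) auto
      from order_tendstoD(1)[OF this, of 0] show "\<forall>\<^sub>F k in sequentially. q j k < q (Suc j) k"
        using t(3)[of j] j by simp
    qed simp
    then have "\<forall>\<^sub>F k in sequentially. (n, \<lambda>j. q j k) \<in> rational_partitions T"
      by eventually_elim (use q in \<open>auto simp: rational_partitions_def partitions_def\<close>)
    then have le: "\<forall>\<^sub>F k in sequentially. part_value p x (n, \<lambda>j. q j k)
        \<le> (SUP \<pi>\<in>rational_partitions T. part_value p x \<pi>)"
      by eventually_elim (rule SUP_upper)
    have "(\<lambda>k. part_value p x (n, \<lambda>j. q j k)) \<longlonglongrightarrow> part_value p x (n, t)"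
      unfolding part_value_def prod.case using \<open>0 < p\<close>
      by (intro tendsto_ennrealI tendsto_powr' tendsto_sum tendsto_dist q_lim tendsto_const)
        (auto intro!: always_eventually sum_nonneg)
    from tendsto_upperbound[OF this le]
    show "ennreal ((\<Sum>j<n. dist (x (t j)) (x (t (Suc j))) powr p) powr (1 / p))
      \<le> (SUP \<pi>\<in>rational_partitions T. part_value p x \<pi>)"
      by (simp add: part_value_def)
  qed
qed

section \<open>Times of stationarity\<close>

lemma open_Z_set: "open (Z_set T Z)"
  by (auto simp: Z_set_def)

lemma zero_in_R_set: "0 \<le> T \<Longrightarrow> 0 \<in> R_set T Z"
  by (auto simp: R_set_def Z_set_def stationary_interval_def)

lemma R_set_subset: "R_set T Z \<subseteq> {0..T}"
  by (auto simp: R_set_def)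

definition last_regular :: "real \<Rightarrow> ('w, 'e) markov_process \<Rightarrow> real \<Rightarrow> real" where
  "last_regular T Z t = Sup (R_set T Z \<inter> {..t})"

text \<open>The complement of the open set \<open>Z_set T Z\<close> in \<open>{0..T}\<close> is
  closed and contains 0, so the supremum is attained.\<close>

lemma last_regular:
  assumes "t \<in> {0..T}"
  shows "last_regular T Z t \<in> R_set T Z" "last_regular T Z t \<le> t"
    "{last_regular T Z t<..t} \<subseteq> Z_set T Z"
proof -
  let ?S = "R_set T Z \<inter> {..t}"
  have "closed ?S" unfolding R_set_def by (intro closed_Int closed_Diff open_Z_set) auto
  moreover have "0 \<in> ?S" using assms zero_in_R_set[of T Z] by auto
  moreover have bdd: "bdd_above ?S" by auto
  ultimately have "last_regular T Z t \<in> ?S"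
    unfolding last_regular_def by (intro closed_contains_Sup) auto
  then show *: "last_regular T Z t \<in> R_set T Z" "last_regular T Z t \<le> t" by auto
  show "{last_regular T Z t<..t} \<subseteq> Z_set T Z"
  proof
    fix u assume u: "u \<in> {last_regular T Z t<..t}"
    then have "u \<notin> ?S"
      using cSup_upper[OF _ bdd, of u] by (auto simp: last_regular_def)
    moreover have "u \<in> {0..T}" using u * R_set_subset assms by fastforce
    ultimately show "u \<in> Z_set T Z" using u by (auto simp: R_set_def)
  qed
qed

lemma last_regular_mono:
  assumes "0 \<le> s" "s \<le> t" "t \<le> T"
  shows "last_regular T Z s \<le> last_regular T Z t"
  unfolding last_regular_def
  using zero_in_R_set[of T Z] assms by (intro cSup_subset_mono) auto

text \<open>Uncountably many stationary intervals may cover the times after \<open>s\<close> up to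
  \<open>t\<close>, so their null sets cannot simply be united. Almost sure equality is instead
  treated as an equivalence relation between times: it is locally constant, hence constant on a
  connected set. The left end \<open>s\<close> lies in no stationary interval and is reached by
  right continuity.\<close>

lemma AE_eq_last_regular:
  fixes Z :: "('w, 'e::polish_space) markov_process"
  assumes Z: "cadlag_strong_markov T Z" and t: "t \<in> {0..T}"
  shows "AE \<omega> in mp_space Z. mp_val Z t \<omega> = mp_val Z (last_regular T Z t) \<omega>"
proof (cases "last_regular T Z t = t")
  case False
  define s where "s = last_regular T Z t"
  have s: "0 \<le> s" "s < t" "{s<..t} \<subseteq> Z_set T Z"
    using last_regular[OF t, of Z] False R_set_subset[of T Z] by (auto simp: s_def)
  define R where "R u v \<longleftrightarrow> (AE \<omega> in mp_space Z. mp_val Z u \<omega> = mp_val Z v \<omega>)" for u v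
  have R: "R u t" if "u \<in> {s<..t}" for u
  proof (rule connected_equivalence_relation[of "{s<..t}"])
    show "R x y \<Longrightarrow> R y x" for x y unfolding R_def by (auto simp: eq_commute)
    show "R x y \<Longrightarrow> R y z \<Longrightarrow> R x z" for x y z
      unfolding R_def by (elim AE_mp, intro AE_I2) auto
    fix a assume a: "a \<in> {s<..t}"
    then obtain l r where lr: "stationary_interval T Z l r" "a \<in> {l<..<r}"
      using s(3) by (fastforce simp: Z_set_def)
    \<comment> \<open>Both values agree almost surely with the value at the left endpoint
      \<open>l\<close>, which need not lie in \<open>{s<..t}\<close>.\<close>
    have "R a x" if "x \<in> {l<..<r}" for x
      using lr that unfolding R_def stationary_interval_def by (auto elim!: eventually_mono)
    then show "\<exists>U. openin (top_of_set {s<..t}) U \<and> a \<in> U \<and> (\<forall>x\<in>U. R a x)"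
      using a lr by (intro exI[of _ "{s<..t} \<inter> {l<..<r}"]) (auto intro: openin_open_Int)
  qed (use that s in auto)
  \<comment> \<open>A countable sequence of times, so that one null set suffices when passing to the
    limit at \<open>s\<close>.\<close>
  define u where "u k = s + (t - s) / real (Suc k)" for k
  have u: "u k \<in> {s<..t}" for k
  proof -
    have "(t - s) / real (Suc k) \<le> (t - s) / 1" using s by (intro divide_left_mono) auto
    then show ?thesis using s by (simp add: u_def)
  qed
  have "(\<lambda>k. s + (t - s) / real (Suc k)) \<longlonglongrightarrow> s + 0"
    by (intro tendsto_add tendsto_const LIMSEQ_Suc[OF lim_const_over_n])
  then have "u \<longlonglongrightarrow> s" by (simp add: u_def[abs_def])
  then have u_lim: "filterlim u (at_right s) sequentially"
    using u by (intro tendsto_imp_filterlim_at_right) auto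
  have "AE \<omega> in mp_space Z. \<forall>k. mp_val Z (u k) \<omega> = mp_val Z t \<omega>"
    using R[OF u] by (simp add: AE_all_countable R_def)
  then have "AE \<omega> in mp_space Z. mp_val Z t \<omega> = mp_val Z s \<omega>"
  proof (rule AE_mp, intro AE_I2 impI)
    fix \<omega> assume w: "\<omega> \<in> space (mp_space Z)" "\<forall>k. mp_val Z (u k) \<omega> = mp_val Z t \<omega>"
    have "((\<lambda>v. mp_val Z v \<omega>) \<longlongrightarrow> mp_val Z s \<omega>) (at_right s)"
      using cadlag_strong_markovD(5)[OF Z w(1)] s t by (auto simp: cadlag_on_def)
    from filterlim_compose[OF this u_lim] have "(\<lambda>k. mp_val Z t \<omega>) \<longlonglongrightarrow> mp_val Z s \<omega>"
      using w(2) by simp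
    then show "mp_val Z t \<omega> = mp_val Z s \<omega>" by (simp add: LIMSEQ_const_iff)
  qed
  then show ?thesis by (simp add: s_def)
qed simp

section \<open>Uniform tail bounds\<close>

lemma finite_set_mono_enumeration:
  fixes D :: "real set"
  assumes "finite D" "D \<noteq> {}"
  obtains t :: "nat \<Rightarrow> real" and n where "mono t" "range t = D" "t ` {..n} = D"
proof
  define l where "l = sorted_list_of_set D"
  have l: "set l = D" "sorted l" using assms by (auto simp: l_def)
  then have "l \<noteq> []" using assms by auto
  \<comment> \<open>The sorted list is continued by its last element, since samples are indexed by
    all natural numbers.\<close>
  define t where "t i = l ! min i (length l - 1)" for i
  show "mono t" unfolding t_def using l \<open>l \<noteq> []\<close>
    by (intro monoI sorted_nth_mono) (auto simp: min_le_iff_disj min_less_iff_disj)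
  have "min i (length l - 1) < length l" for i using \<open>l \<noteq> []\<close> by (simp add: min_less_iff_disj)
  then have "t i \<in> D" for i unfolding t_def l(1)[symmetric] by (rule nth_mem)
  moreover have "d \<in> t ` {..length l - 1}" if d: "d \<in> D" for d
  proof -
    obtain i where "i < length l" "l ! i = d" using d unfolding l(1)[symmetric] in_set_conv_nth by blast
    then show ?thesis by (intro image_eqI[of _ _ i]) (auto simp: t_def min_def)
  qed
  ultimately show "range t = D" "t ` {..length l - 1} = D" by blast+
qed

text \<open>Hypothesis (b) is used with \<open>\<delta> = r / 3\<close>, the threshold that
  \<open>markov_step_le\<close> turns into \<open>r\<close>. This gives the time span
  \<open>a * (r / 3) powr \<kappa>\<close> and the range \<open>r \<le> 3 * b\<close>. The sampled
  times lie in \<open>R_set T Z\<close> because (b) covers only such starting times.\<close>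

lemma sampled_process_of_markov:
  fixes Z :: "('w, 'e::polish_space) markov_process"
  assumes Z: "cadlag_strong_markov T Z" and "0 < a" "0 \<le> c" "c < 1/2"
    and small: "\<And>\<delta> s x t. \<lbrakk>0 < \<delta>; \<delta> \<le> b; s \<in> R_set T Z; t \<in> {s..s + a * \<delta> powr \<kappa>} \<inter> {0..T}\<rbrakk> \<Longrightarrow>
      \<P>(\<omega> in mp_law Z s x. dist (\<omega> s) (\<omega> t) > \<delta>) \<le> c"
    and t: "mono t" "range t \<subseteq> R_set T Z" and r: "0 < r" "r \<le> 3 * b"
  shows "sampled_process (mp_space Z) (\<lambda>i. mp_filt Z (t i)) (\<lambda>i. mp_val Z (t i)) t r
    (a / 3 powr \<kappa> * r powr \<kappa>) c"
proof -
  note D = cadlag_strong_markovD[OF Z]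
  interpret prob_space "mp_space Z" by (rule D)
  interpret F: filtration "space (mp_space Z)" "mp_filt Z" by (rule D)
  have tT: "t i \<in> {0..T}" for i using t R_set_subset[of T Z] by blast
  have tR: "t i \<in> R_set T Z" for i using t by blast
  have h: "a / 3 powr \<kappa> * r powr \<kappa> = a * (r / 3) powr \<kappa>"
    using r by (simp add: powr_divide)
  show ?thesis
  proof unfold_locales
    show "subalgebra (mp_space Z) (mp_filt Z (t i))" for i by (rule D)
    show "sets (mp_filt Z (t i)) \<subseteq> sets (mp_filt Z (t k))" if "i \<le> k" for i k
      using that t(1) by (intro F.sets_F_mono) (auto simp: mono_def)
    show "mp_val Z (t i) \<in> borel_measurable (mp_filt Z (t i))" for i by (rule D(4)[OF tT])
    show "mono t" by (rule t)
    show "0 \<le> r" "0 < a / 3 powr \<kappa> * r powr \<kappa>" "0 \<le> c" "c < 1/2" using assms by auto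
    fix i k :: nat and A
    assume ik: "i \<le> k" "t k - t i \<le> a / 3 powr \<kappa> * r powr \<kappa>" and A: "A \<in> sets (mp_filt Z (t i))"
    have le: "t i \<le> t k" using ik t(1) by (auto simp: mono_def)
    have "prob (A \<inter> {\<omega> \<in> space (mp_space Z). 3 * (r / 3) < dist (mp_val Z (t i) \<omega>) (mp_val Z (t k) \<omega>)})
      \<le> c * prob A"
    proof (rule markov_step_le[OF Z _ le _ A])
      show "measure (mp_trans Z (t i) (t k) x) {y. r / 3 < dist x y} \<le> c" for x
      proof (rule markov_law_transition_le[OF D(6)[OF tT] le])
        show "\<P>(\<omega> in mp_law Z (t i) x. r / 3 < dist (\<omega> (t i)) (\<omega> (t k))) \<le> c"
          using r ik le tT[of k] unfolding h by (intro small tR) auto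
      qed (use tT[of k] in auto)
      have "mp_trans Z (t i) (t k) \<in> borel \<rightarrow>\<^sub>M prob_algebra borel"
        using Z tT[of i] tT[of k] le
        by (auto simp: cadlag_strong_markov_def Let_def transition_function_def)
      then have "mp_trans Z (t i) (t k) x \<in> space (prob_algebra borel)" for x
        by (rule measurable_space) simp
      then show "prob_space (mp_trans Z (t i) (t k) x)" "sets (mp_trans Z (t i) (t k) x) = sets borel" for x
        by (auto simp: space_prob_algebra)
    qed (use r tT[of i] tT[of k] in auto)
    then show "prob (A \<inter> {\<omega> \<in> space (mp_space Z). r < dist (mp_val Z (t i) \<omega>) (mp_val Z (t k) \<omega>)})
      \<le> c * prob A" by simp
  qed
qed

lemma measurable_part_value:
  fixes Z :: "('w, 'e::polish_space) markov_process"
  assumes Z: "cadlag_strong_markov T Z" and \<pi>: "\<pi> \<in> partitions T"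
  shows "(\<lambda>\<omega>. part_value p (\<lambda>t. mp_val Z t \<omega>) \<pi>) \<in> borel_measurable (mp_space Z)"
proof -
  obtain n t where nt: "\<pi> = (n, t)" by (cases \<pi>)
  have [measurable]: "mp_val Z (t j) \<in> borel_measurable (mp_space Z)" if "j \<le> n" for j
    using partitions_range[of n t T j] \<pi> that nt by (intro cadlag_strong_markov_measurable[OF Z]) auto
  have "(\<lambda>\<omega>. \<Sum>j<n. dist (mp_val Z (t j) \<omega>) (mp_val Z (t (Suc j)) \<omega>) powr p)
      \<in> borel_measurable (mp_space Z)"
    by (intro borel_measurable_sum powr_real_measurable borel_measurable_dist) auto
  then show ?thesis unfolding part_value_def nt prod.case by measurable
qed

text \<open>The supremum runs over uncountably many partitions, but on cadlag paths it agrees with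
  one over a countable family.\<close>

lemma measurable_pvar:
  fixes Z :: "('w, 'e::polish_space) markov_process"
  assumes Z: "cadlag_strong_markov T Z" and "0 < p"
  shows "(\<lambda>\<omega>. pvar p T (\<lambda>t. mp_val Z t \<omega>)) \<in> borel_measurable (mp_space Z)"
proof -
  have "(\<lambda>\<omega>. SUP \<pi>\<in>rational_partitions T. part_value p (\<lambda>t. mp_val Z t \<omega>) \<pi>)
      \<in> borel_measurable (mp_space Z)"
    using rational_partitions_subset
    by (intro borel_measurable_SUP countable_rational_partitions measurable_part_value[OF Z]) auto
  then show ?thesis
    by (rule measurable_cong[THEN iffD2, rotated])
      (intro pvar_eq_SUP_rational cadlag_strong_markovD(5)[OF Z] \<open>0 < p\<close>)
qed

text \<open>The last assumption on \<open>C\<close> is what \<open>power_sums_tail\<close> provides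
  on one probability space; keeping it as an assumption allows one \<open>C\<close> for the whole
  collection. All points of the finitely many partitions are moved to their last regular times, and
  these form the sample. Points may coalesce there, so only a nondecreasing index sequence
  results.\<close>

lemma finite_partitions_tail:
  fixes Z :: "('w, 'e::polish_space) markov_process"
  assumes Z: "cadlag_strong_markov T Z" and "0 < a" "0 \<le> c" "c < 1/2" "0 < p" "0 < T"
    and osc[measurable]: "(\<lambda>\<omega>. max_osc T (\<lambda>t. mp_val Z t \<omega>)) \<in> borel_measurable (mp_space Z)"
    and small: "\<And>\<delta> s x t. \<lbrakk>0 < \<delta>; \<delta> \<le> b; s \<in> R_set T Z; t \<in> {s..s + a * \<delta> powr \<kappa>} \<inter> {0..T}\<rbrakk> \<Longrightarrow>
      \<P>(\<omega> in mp_law Z s x. dist (\<omega> s) (\<omega> t) > \<delta>) \<le> c"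
    and C: "0 \<le> C" "\<And>G (Y :: nat \<Rightarrow> 'w \<Rightarrow> 'e) t n.
    (\<And>r. 0 < r \<Longrightarrow> r \<le> 3 * b \<Longrightarrow> sampled_process (mp_space Z) G Y t r (a / 3 powr \<kappa> * r powr \<kappa>) c) \<Longrightarrow>
    (\<And>i. 0 \<le> t i \<and> t i \<le> T) \<Longrightarrow>
    \<exists>B\<in>sets (mp_space Z). measure (mp_space Z) B \<le> \<epsilon> \<and> (\<forall>\<omega>\<in>space (mp_space Z) - B. \<forall>m u.
      (\<forall>j<m. u j \<le> u (Suc j)) \<longrightarrow> u m \<le> n \<longrightarrow> (\<forall>i k. dist (Y i \<omega>) (Y k \<omega>) \<le> K) \<longrightarrow>
      (\<Sum>j<m. dist (Y (u j) \<omega>) (Y (u (Suc j)) \<omega>) powr p) \<le> C)"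
    and \<D>: "finite \<D>" "\<D> \<subseteq> partitions T"
  shows "\<P>(\<omega> in mp_space Z. \<exists>\<pi>\<in>\<D>. ennreal (C powr (1 / p)) < part_value p (\<lambda>t. mp_val Z t \<omega>) \<pi>)
    \<le> \<epsilon> + \<P>(\<omega> in mp_space Z. K < max_osc T (\<lambda>t. mp_val Z t \<omega>))"
proof -
  let ?M = "mp_space Z" and ?X = "mp_val Z" and ?L = "last_regular T Z"
  interpret prob_space ?M by (rule cadlag_strong_markovD[OF Z])
  define D where "D = insert 0 (\<Union>(n, t)\<in>\<D>. t ` {..n})"
  have D: "finite D" "D \<subseteq> {0..T}" "0 \<in> D"
    using \<D> partitions_range \<open>0 < T\<close> by (auto simp: D_def)
  obtain t :: "nat \<Rightarrow> real" and n where t: "mono t" "range t = ?L ` D" "t ` {..n} = ?L ` D"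
    using finite_set_mono_enumeration[of "?L ` D"] D by auto
  have range: "range t \<subseteq> R_set T Z"
    unfolding t(2) using D(2) by (intro image_subsetI last_regular(1)) blast
  then have tT: "t i \<in> {0..T}" for i using R_set_subset[of T Z] by (meson rangeI subsetD)
  have "\<exists>B\<in>sets ?M. measure ?M B \<le> \<epsilon> \<and> (\<forall>\<omega>\<in>space ?M - B. \<forall>m u.
      (\<forall>j<m. u j \<le> u (Suc j)) \<longrightarrow> u m \<le> n \<longrightarrow> (\<forall>i k. dist (?X (t i) \<omega>) (?X (t k) \<omega>) \<le> K) \<longrightarrow>
      (\<Sum>j<m. dist (?X (t (u j)) \<omega>) (?X (t (u (Suc j))) \<omega>) powr p) \<le> C)"
  proof (rule C(2))
    show "sampled_process ?M (\<lambda>i. mp_filt Z (t i)) (\<lambda>i. ?X (t i)) t r (a / 3 powr \<kappa> * r powr \<kappa>) c"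
      if "0 < r" "r \<le> 3 * b" for r
      by (rule sampled_process_of_markov[OF Z assms(2-4) small t(1) range that])
  qed (use tT in auto)
  then obtain B where B[measurable]: "B \<in> sets ?M" and "prob B \<le> \<epsilon>" and sum_le:
    "\<And>\<omega> m u. \<lbrakk>\<omega> \<in> space ?M - B; \<forall>j<m. u j \<le> u (Suc j); u m \<le> n;
       \<forall>i k. dist (?X (t i) \<omega>) (?X (t k) \<omega>) \<le> K\<rbrakk> \<Longrightarrow>
      (\<Sum>j<m. dist (?X (t (u j)) \<omega>) (?X (t (u (Suc j))) \<omega>) powr p) \<le> C"
    by blast
  \<comment> \<open>Values of \<open>t\<close> repeat. The least index depends on
    \<open>?L d\<close> only, so coalescing points receive equal indices, which the monotonicity
    below relies on.\<close>
  define index where "index d = (LEAST i. t i = ?L d)" for d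
  have index: "t (index d) = ?L d" "index d \<le> n" if d: "d \<in> D" for d
  proof -
    have "?L d \<in> t ` {..n}" unfolding t(3) using d by (rule imageI)
    then obtain i where i: "t i = ?L d" "i \<le> n" by auto
    show "t (index d) = ?L d" unfolding index_def by (rule LeastI[of _ i]) (rule i)
    have "index d \<le> i" unfolding index_def by (rule Least_le) (rule i)
    then show "index d \<le> n" using i by simp
  qed
  have index_mono: "index d \<le> index d'" if "d \<in> D" "d' \<in> D" "d \<le> d'" for d d'
  proof (rule ccontr)
    assume "\<not> index d \<le> index d'"
    then have less: "index d' < index d" by simp
    then have "t (index d') \<le> t (index d)" using t(1) by (simp add: monoD)
    moreover have "?L d \<le> ?L d'"
      using that D(2) by (intro last_regular_mono) auto
    ultimately have "?L d' = ?L d" using index(1) that by simp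
    then show False using less by (simp add: index_def)
  qed
  have "AE \<omega> in ?M. \<forall>d\<in>D. ?X d \<omega> = ?X (?L d) \<omega>"
    using D AE_eq_last_regular[OF Z] by (intro AE_finite_allI) auto
  then have "AE \<omega> in ?M.
    \<omega> \<in> {\<omega> \<in> space ?M. \<exists>\<pi>\<in>\<D>. ennreal (C powr (1 / p)) < part_value p (\<lambda>t. ?X t \<omega>) \<pi>} \<longrightarrow>
    \<omega> \<in> B \<union> {\<omega> \<in> space ?M. K < max_osc T (\<lambda>t. ?X t \<omega>)}"
  proof (rule AE_mp, intro AE_I2 impI)
    fix \<omega> assume w: "\<omega> \<in> space ?M" and eq: "\<forall>d\<in>D. ?X d \<omega> = ?X (?L d) \<omega>"
      and "\<omega> \<in> {\<omega> \<in> space ?M. \<exists>\<pi>\<in>\<D>. ennreal (C powr (1 / p)) < part_value p (\<lambda>t. ?X t \<omega>) \<pi>}"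
    then obtain m v where mv: "(m, v) \<in> \<D>"
      and large: "ennreal (C powr (1 / p)) < part_value p (\<lambda>t. ?X t \<omega>) (m, v)" by auto
    have v: "v j \<in> D" if "j \<le> m" for j using mv that by (auto simp: D_def)
    show "\<omega> \<in> B \<union> {\<omega> \<in> space ?M. K < max_osc T (\<lambda>t. ?X t \<omega>)}"
    proof (rule ccontr)
      assume "\<not> ?thesis"
      then have w': "\<omega> \<in> space ?M - B" "max_osc T (\<lambda>t. ?X t \<omega>) \<le> K" using w by auto
      have "dist (?X (t i) \<omega>) (?X (t k) \<omega>) \<le> K" for i k
        using dist_le_max_osc[OF cadlag_strong_markovD(5)[OF Z w] tT tT] w'(2) by (rule order_trans)
      moreover have "index (v j) \<le> index (v (Suc j))" if "j < m" for j
        using that mv \<D>(2) partitions_mono[of m v T j "Suc j"] by (intro index_mono v) auto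
      ultimately have "(\<Sum>j<m. dist (?X (t (index (v j))) \<omega>) (?X (t (index (v (Suc j)))) \<omega>) powr p) \<le> C"
        using index(2)[OF v] by (intro sum_le[OF w'(1), of m "\<lambda>j. index (v j)"]) auto
      also have "(\<Sum>j<m. dist (?X (t (index (v j))) \<omega>) (?X (t (index (v (Suc j)))) \<omega>) powr p)
          = (\<Sum>j<m. dist (?X (v j) \<omega>) (?X (v (Suc j)) \<omega>) powr p)"
        using eq v by (intro sum.cong) (simp_all add: index(1))
      finally have "(\<Sum>j<m. dist (?X (v j) \<omega>) (?X (v (Suc j)) \<omega>) powr p) powr (1 / p) \<le> C powr (1 / p)"
        using \<open>0 < p\<close> by (intro powr_mono2 sum_nonneg) auto
      then show False using large by (simp add: part_value_def leD[OF ennreal_leI])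
    qed
  qed
  then have "\<P>(\<omega> in ?M. \<exists>\<pi>\<in>\<D>. ennreal (C powr (1 / p)) < part_value p (\<lambda>t. ?X t \<omega>) \<pi>)
      \<le> prob (B \<union> {\<omega> \<in> space ?M. K < max_osc T (\<lambda>t. ?X t \<omega>)})"
    by (rule finite_measure_mono_AE) measurable
  also have "\<dots> \<le> prob B + prob {\<omega> \<in> space ?M. K < max_osc T (\<lambda>t. ?X t \<omega>)}"
    by (intro measure_Un_le) measurable
  finally show ?thesis using \<open>prob B \<le> \<epsilon>\<close> by simp
qed

text \<open>Finite initial segments of an enumeration of the rational partitions give increasing
  events with the same bound, and continuity from below passes it to the union. The strict
  inequality makes this union exactly the tail event of the supremum.\<close>

lemma pvar_tail_le:
  fixes Z :: "('w, 'e::polish_space) markov_process"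
  assumes Z: "cadlag_strong_markov T Z" and "0 < p" "0 < T"
    and fin: "\<And>\<D>. finite \<D> \<Longrightarrow> \<D> \<subseteq> partitions T \<Longrightarrow>
      \<P>(\<omega> in mp_space Z. \<exists>\<pi>\<in>\<D>. C < part_value p (\<lambda>t. mp_val Z t \<omega>) \<pi>) \<le> \<epsilon>"
  shows "\<P>(\<omega> in mp_space Z. C < pvar p T (\<lambda>t. mp_val Z t \<omega>)) \<le> \<epsilon>"
proof -
  let ?M = "mp_space Z" and ?v = "\<lambda>\<omega>. part_value p (\<lambda>t. mp_val Z t \<omega>)"
  interpret prob_space ?M by (rule cadlag_strong_markovD[OF Z])
  define g where "g = from_nat_into (rational_partitions T)"
  have range_g: "range g = rational_partitions T"
    unfolding g_def using rational_partitions_nonempty[OF \<open>0 < T\<close>] countable_rational_partitions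
    by (rule range_from_nat_into)
  then have g: "g i \<in> partitions T" for i using rational_partitions_subset by blast
  note [measurable] = measurable_part_value[OF Z g]
  define A where "A m = {\<omega> \<in> space ?M. \<exists>\<pi>\<in>g ` {..m}. C < ?v \<omega> \<pi>}" for m :: nat
  have A: "range A \<subseteq> sets ?M" unfolding A_def by auto
  moreover have "incseq A" unfolding A_def incseq_def by fastforce
  ultimately have "(\<lambda>m. prob (A m)) \<longlonglongrightarrow> prob (\<Union>m. A m)"
    by (rule finite_Lim_measure_incseq)
  moreover have "prob (A m) \<le> \<epsilon>" for m unfolding A_def using g by (intro fin) auto
  ultimately have "prob (\<Union>m. A m) \<le> \<epsilon>" by (intro LIMSEQ_le_const2) auto
  also have "(\<Union>m. A m) = {\<omega> \<in> space ?M. C < pvar p T (\<lambda>t. mp_val Z t \<omega>)}"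
  proof (intro set_eqI)
    fix \<omega>
    have "C < pvar p T (\<lambda>t. mp_val Z t \<omega>) \<longleftrightarrow> (\<exists>i. C < ?v \<omega> (g i))" if "\<omega> \<in> space ?M"
      using pvar_eq_SUP_rational[OF cadlag_strong_markovD(5)[OF Z that] \<open>0 < p\<close>]
      by (simp add: less_SUP_iff range_g[symmetric])
    then show "\<omega> \<in> (\<Union>m. A m) \<longleftrightarrow> \<omega> \<in> {\<omega> \<in> space ?M. C < pvar p T (\<lambda>t. mp_val Z t \<omega>)}"
      by (auto simp: A_def)
  qed
  finally show ?thesis .
qed


text \<open>Half of \<epsilon> pays for oscillations above \<open>K\<close>, half for the power sums
  of paths with oscillation at most \<open>K\<close>. The level \<open>K\<close> comes from
  tightness and is chosen before \<open>C\<close>, which depends on it.\<close>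

lemma uniform_pvar_tail:
  fixes \<M> :: "('w, 'e::polish_space) markov_process set"
  assumes "0 < T" "0 < a" "0 < \<kappa>" "0 < b" "0 \<le> c" "c < 1/2" "\<kappa> < p" "0 < \<epsilon>"
    and Z: "\<And>Z. Z \<in> \<M> \<Longrightarrow> cadlag_strong_markov T Z"
    and tight: "tight_family \<M> mp_space (\<lambda>Z \<omega>. max_osc T (\<lambda>t. mp_val Z t \<omega>))"
    and small: "\<And>Z \<delta> s x t. \<lbrakk>Z \<in> \<M>; 0 < \<delta>; \<delta> \<le> b; s \<in> R_set T Z; t \<in> {s..s + a * \<delta> powr \<kappa>} \<inter> {0..T}\<rbrakk> \<Longrightarrow>
      \<P>(\<omega> in mp_law Z s x. dist (\<omega> s) (\<omega> t) > \<delta>) \<le> c"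
  obtains C where "0 \<le> C"
    "\<And>Z. Z \<in> \<M> \<Longrightarrow> \<P>(\<omega> in mp_space Z. ennreal C < pvar p T (\<lambda>t. mp_val Z t \<omega>)) \<le> \<epsilon>"
proof -
  have "0 < p" using assms by simp
  obtain S where S: "compact S"
    "\<And>Z. Z \<in> \<M> \<Longrightarrow> \<P>(\<omega> in mp_space Z. max_osc T (\<lambda>t. mp_val Z t \<omega>) \<notin> S) \<le> \<epsilon> / 2"
    using tight \<open>0 < \<epsilon>\<close> unfolding tight_family_def by (meson half_gt_zero)
  from compact_imp_bounded[OF S(1)] obtain K where K: "\<And>y. y \<in> S \<Longrightarrow> \<bar>y\<bar> \<le> K"
    by (auto simp: bounded_iff)
  have "0 < a / 3 powr \<kappa>" "0 < 3 * b" "0 \<le> T" "0 < \<epsilon> / 2" using assms by auto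
  from power_sums_tail[OF this(1) \<open>0 < \<kappa>\<close> this(2) \<open>c < 1/2\<close> \<open>\<kappa> < p\<close> this(3,4), where K = K]
  obtain C where C: "0 \<le> C" "\<And>(M :: 'w measure) G (Y :: nat \<Rightarrow> 'w \<Rightarrow> 'e) t n.
    (\<And>r. 0 < r \<Longrightarrow> r \<le> 3 * b \<Longrightarrow> sampled_process M G Y t r (a / 3 powr \<kappa> * r powr \<kappa>) c) \<Longrightarrow>
    (\<And>i. 0 \<le> t i \<and> t i \<le> T) \<Longrightarrow>
    \<exists>B\<in>sets M. measure M B \<le> \<epsilon> / 2 \<and> (\<forall>\<omega>\<in>space M - B. \<forall>m u.
      (\<forall>j<m. u j \<le> u (Suc j)) \<longrightarrow> u m \<le> n \<longrightarrow> (\<forall>i k. dist (Y i \<omega>) (Y k \<omega>) \<le> K) \<longrightarrow>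
      (\<Sum>j<m. dist (Y (u j) \<omega>) (Y (u (Suc j)) \<omega>) powr p) \<le> C)"
    by blast
  show thesis
  proof (rule that[of "C powr (1 / p)"])
    fix Z assume ZM: "Z \<in> \<M>"
    interpret prob_space "mp_space Z" by (rule cadlag_strong_markovD[OF Z[OF ZM]])
    have osc[measurable]: "(\<lambda>\<omega>. max_osc T (\<lambda>t. mp_val Z t \<omega>)) \<in> borel_measurable (mp_space Z)"
      using tight ZM by (auto simp: tight_family_def)
    have [measurable]: "S \<in> sets borel" using S(1) by (auto intro: borel_closed compact_imp_closed)
    have "prob {\<omega> \<in> space (mp_space Z). K < max_osc T (\<lambda>t. mp_val Z t \<omega>)}
      \<le> prob {\<omega> \<in> space (mp_space Z). max_osc T (\<lambda>t. mp_val Z t \<omega>) \<notin> S}"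
      using K by (intro finite_measure_mono) (fastforce, measurable)
    then have osc_le: "prob {\<omega> \<in> space (mp_space Z). K < max_osc T (\<lambda>t. mp_val Z t \<omega>)} \<le> \<epsilon> / 2"
      using S(2)[OF ZM] by simp
    show "\<P>(\<omega> in mp_space Z. ennreal (C powr (1 / p)) < pvar p T (\<lambda>t. mp_val Z t \<omega>)) \<le> \<epsilon>"
    proof (rule pvar_tail_le[OF Z[OF ZM] \<open>0 < p\<close> \<open>0 < T\<close>])
      fix \<D> :: "(nat \<times> (nat \<Rightarrow> real)) set" assume "finite \<D>" "\<D> \<subseteq> partitions T"
      have "\<P>(\<omega> in mp_space Z. \<exists>\<pi>\<in>\<D>. ennreal (C powr (1 / p)) < part_value p (\<lambda>t. mp_val Z t \<omega>) \<pi>)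
          \<le> \<epsilon> / 2 + \<P>(\<omega> in mp_space Z. K < max_osc T (\<lambda>t. mp_val Z t \<omega>))"
        by (rule finite_partitions_tail[where a = a and b = b and \<kappa> = \<kappa> and c = c]) (fact | rule small[OF ZM] Z[OF ZM] C(2); assumption)+
      then show "\<P>(\<omega> in mp_space Z. \<exists>\<pi>\<in>\<D>. ennreal (C powr (1 / p)) < part_value p (\<lambda>t. mp_val Z t \<omega>) \<pi>) \<le> \<epsilon>"
        using osc_le by simp
    qed
  qed simp
qed

text \<open>\<open>enn2real\<close> sends infinity to 0, so tightness of the real versions alone
  would not exclude infinite variation; hence the separate almost sure finiteness.\<close>

theorem theorem4p8:
  fixes T a \<kappa> b c p :: real
    and \<M> :: "('w, 'e::polish_space) markov_process set"
    and h :: "real \<Rightarrow> real"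
  assumes "0 < T"
    and "\<And>Z. Z \<in> \<M> \<Longrightarrow> cadlag_strong_markov T Z"
    and "tight_family \<M> mp_space (\<lambda>Z \<omega>. max_osc T (\<lambda>t. mp_val Z t \<omega>))"
    and "a > 0" "\<kappa> > 0" "b > 0" "0 \<le> c" "c < 1 / 2"
    and "\<And>\<delta>. h \<delta> = a * \<delta> powr \<kappa>"
    and "\<And>\<delta>. \<delta> \<in> {0<..b} \<Longrightarrow>
           \<forall>Z\<in>\<M>. \<forall>s\<in>R_set T Z. \<forall>x. \<forall>t\<in>{s..s + h \<delta>} \<inter> {0..T}.
             \<P>(\<omega> in mp_law Z s x. dist (\<omega> s) (\<omega> t) > \<delta>) \<le> c"
    and "p > \<kappa>"
  shows "(\<forall>Z\<in>\<M>. AE \<omega> in mp_space Z. pvar p T (\<lambda>t. mp_val Z t \<omega>) < \<infinity>) \<and>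
         tight_family \<M> mp_space (\<lambda>Z \<omega>. enn2real (pvar p T (\<lambda>t. mp_val Z t \<omega>)))"
proof -
  have small: "\<P>(\<omega> in mp_law Z s x. dist (\<omega> s) (\<omega> t) > \<delta>) \<le> c"
    if "Z \<in> \<M>" "0 < \<delta>" "\<delta> \<le> b" "s \<in> R_set T Z" "t \<in> {s..s + a * \<delta> powr \<kappa>} \<inter> {0..T}" for Z \<delta> s x t
    using assms(10)[of \<delta>] that unfolding assms(9) by simp
  have "\<exists>C\<ge>0. \<forall>Z\<in>\<M>. \<P>(\<omega> in mp_space Z. ennreal C < pvar p T (\<lambda>t. mp_val Z t \<omega>)) \<le> \<epsilon>"
    if "0 < \<epsilon>" for \<epsilon>
  proof (rule uniform_pvar_tail[where a = a and b = b and c = c and \<kappa> = \<kappa> and p = p and T = T and \<M> = \<M>])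
    fix C assume "0 \<le> C"
      "\<And>Z. Z \<in> \<M> \<Longrightarrow> \<P>(\<omega> in mp_space Z. ennreal C < pvar p T (\<lambda>t. mp_val Z t \<omega>)) \<le> \<epsilon>"
    then show ?thesis by blast
  qed (fact assms that | rule small assms(2); assumption)+
  then obtain C where C: "\<And>\<epsilon>. 0 < \<epsilon> \<Longrightarrow> 0 \<le> C \<epsilon>"
    "\<And>\<epsilon> Z. 0 < \<epsilon> \<Longrightarrow> Z \<in> \<M> \<Longrightarrow> \<P>(\<omega> in mp_space Z. ennreal (C \<epsilon>) < pvar p T (\<lambda>t. mp_val Z t \<omega>)) \<le> \<epsilon>"
    by metis
  have meas: "(\<lambda>\<omega>. pvar p T (\<lambda>t. mp_val Z t \<omega>)) \<in> borel_measurable (mp_space Z)" if "Z \<in> \<M>" for Z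
    using assms that by (intro measurable_pvar) auto
  show ?thesis
  proof (intro conjI ballI)
    fix Z assume Z: "Z \<in> \<M>"
    interpret prob_space "mp_space Z" by (rule cadlag_strong_markovD[OF assms(2)[OF Z]])
    note [measurable] = meas[OF Z]
    \<comment> \<open>The event of infinite variation is contained in every tail event. The summand
      0 matches the form of \<open>field_le_epsilon\<close>.\<close>
    have "prob {\<omega> \<in> space (mp_space Z). pvar p T (\<lambda>t. mp_val Z t \<omega>) = \<infinity>} \<le> 0 + \<epsilon>" if "0 < \<epsilon>" for \<epsilon>
    proof -
      have "prob {\<omega> \<in> space (mp_space Z). pvar p T (\<lambda>t. mp_val Z t \<omega>) = \<infinity>}
        \<le> prob {\<omega> \<in> space (mp_space Z). ennreal (C \<epsilon>) < pvar p T (\<lambda>t. mp_val Z t \<omega>)}"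
        by (intro finite_measure_mono) auto
      then show ?thesis using C(2)[OF that Z] by simp
    qed
    then have "prob {\<omega> \<in> space (mp_space Z). pvar p T (\<lambda>t. mp_val Z t \<omega>) = \<infinity>} \<le> 0"
      by (rule field_le_epsilon)
    then have "prob {\<omega> \<in> space (mp_space Z). pvar p T (\<lambda>t. mp_val Z t \<omega>) = \<infinity>} = 0"
      by (simp add: measure_le_0_iff)
    then show "AE \<omega> in mp_space Z. pvar p T (\<lambda>t. mp_val Z t \<omega>) < \<infinity>"
      by (subst (asm) prob_eq_0) (auto simp: less_top[symmetric])
  next
    show "tight_family \<M> mp_space (\<lambda>Z \<omega>. enn2real (pvar p T (\<lambda>t. mp_val Z t \<omega>)))"
      unfolding tight_family_def
    proof (intro conjI ballI allI impI)
      fix Z assume "Z \<in> \<M>"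
      from meas[OF this] show "(\<lambda>\<omega>. enn2real (pvar p T (\<lambda>t. mp_val Z t \<omega>))) \<in> borel_measurable (mp_space Z)"
        by measurable
    next
      fix \<epsilon> :: real assume "0 < \<epsilon>"
      have "\<P>(\<omega> in mp_space Z. enn2real (pvar p T (\<lambda>t. mp_val Z t \<omega>)) \<notin> {0..C \<epsilon>}) \<le> \<epsilon>" if Z: "Z \<in> \<M>" for Z
      proof -
        interpret prob_space "mp_space Z" by (rule cadlag_strong_markovD[OF assms(2)[OF Z]])
        note [measurable] = meas[OF Z]
        have "prob {\<omega> \<in> space (mp_space Z). enn2real (pvar p T (\<lambda>t. mp_val Z t \<omega>)) \<notin> {0..C \<epsilon>}}
          \<le> prob {\<omega> \<in> space (mp_space Z). ennreal (C \<epsilon>) < pvar p T (\<lambda>t. mp_val Z t \<omega>)}"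
        proof (intro finite_measure_mono subsetI)
          fix \<omega> assume w: "\<omega> \<in> {\<omega> \<in> space (mp_space Z). enn2real (pvar p T (\<lambda>t. mp_val Z t \<omega>)) \<notin> {0..C \<epsilon>}}"
          have "pvar p T (\<lambda>t. mp_val Z t \<omega>) \<le> ennreal (C \<epsilon>) \<Longrightarrow> enn2real (pvar p T (\<lambda>t. mp_val Z t \<omega>)) \<le> C \<epsilon>"
            by (intro enn2real_leI C(1) \<open>0 < \<epsilon>\<close>)
          then show "\<omega> \<in> {\<omega> \<in> space (mp_space Z). ennreal (C \<epsilon>) < pvar p T (\<lambda>t. mp_val Z t \<omega>)}"
            using w by (auto simp: not_le[symmetric])
        qed measurable
        then show ?thesis using C(2)[OF \<open>0 < \<epsilon>\<close> Z] by simp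
      qed
      then show "\<exists>K. compact K \<and> (\<forall>Z\<in>\<M>. \<P>(\<omega> in mp_space Z. enn2real (pvar p T (\<lambda>t. mp_val Z t \<omega>)) \<notin> K) \<le> \<epsilon>)"
        by (intro exI[of _ "{0..C \<epsilon>}"]) auto
    qed
  qed
qed

end
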